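(* Let $\Omega\subset\mathbb{H}^1$ be a bounded domain, $f\in L^2(\Omega)$, and let $A:\mathbb{H}^1\to M_{2\times2}(\mathbb{R})$ have bounded, measurable, $Y$-periodic entries and satisfy, for some constants $\alpha,\beta>0$, $\|A(x)v\|\le\beta\|v\|$ and $\langle A(x)v,v\rangle\ge\alpha\|v\|^2$ for all $x\in\mathbb{H}^1$, $v\in\mathbb{R}^2$. Let $(u,u_1)\in H^1_{\mathbb{H}}(\Omega)\times L^2(\Omega;H^1_{\#,\mathbb{H}}(Y)/\mathbb{R})$ be the solution of $$\int_{\Omega\times Y}A(y)\big(\nabla_{\mathbb{H}}u+\nabla_{\mathbb{H},y}u_1\big)\cdot\big(\nabla_{\mathbb{H}}\phi+\nabla_{\mathbb{H},y}\phi_1\big)\,dx\,dy+\int_{\Omega\times Y}u\phi\,dx\,dy=\int_{\Omega\times Y}f\phi\,dx\,dy$$ for all $(\phi,\phi_1)\in H^1_{\mathbb{H}}(\Omega)\times L^2(\Omega;H^1_{\#,\mathbb{H}}(Y)/\mathbb{R})$. For $i=1,2$ let $Z_i\in H^1_{\#,\mathbb{H}}(Y)/\mathbb{R}$ be the solution of the cell problem $$\int_Y A(y)\nabla_{\mathbb{H},y}Z_i(y)\cdot\nabla_{\mathbb{H},y}\xi(y)\,dy=-\int_Y A(y)e_i\cdot\nabla_{\mathbb{H},y}\xi(y)\,dy\qquad\text{for all }\xi\in H^1_{\#,\mathbb{H}}(Y)/\mathbb{R},$$ where $e_1,e_2$ is the standard basis of $\mathbb{R}^2$. Then $u_1(x,y)=\sum_{i=1}^2Z_i(y)X_iu(x)$,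 and $u$ satisfies $$\int_\Omega A_0\nabla_{\mathbb{H}}u\cdot\nabla_{\mathbb{H}}\phi\,dx+|Y|\int_\Omega u\phi\,dx=|Y|\int_\Omega f\phi\,dx\qquad\text{for all }\phi\in H^1_{\mathbb{H}}(\Omega),$$ where $A_0$ is the constant matrix $$A_0=\int_Y A(y)\left(\begin{bmatrix} 1 & 0 \\ 0 & 1 \end{bmatrix}+\begin{bmatrix} Y_1Z_1 & Y_1Z_2 \\ Y_2Z_1 & Y_2Z_2 \end{bmatrix}\right)dy;$$ that is, $u$ is the weak solution of $-\mathrm{div}_{\mathbb{H}}(A_0\nabla_{\mathbb{H}}u)+|Y|u=|Y|f$ in $\Omega$ with the homogeneous Neumann condition on $\partial\Omega$.
   Context: $\mathbb{H}^1$ is $\mathbb{R}^3$ with the group law $p\cdot q=(p_1+q_1,p_2+q_2,p_3+q_3+2(p_2q_1-p_1q_2))$, dilations $\delta_\lambda(x)=(\lambda x_1,\lambda x_2,\lambda^2x_3)$ for $\lambda>0$, and Lebesgue measure $|\cdot|$. The horizontal vector fields are $X_1=\partial_{x_1}+2x_2\partial_{x_3}$ and $X_2=\partial_{x_2}-2x_1\partial_{x_3}$; $\nabla_{\mathbb{H}}f=(X_1f,X_2f)$ and $\mathrm{div}_{\mathbb{H}}(\phi_1,\phi_2)=X_1\phi_1+X_2\phi_2$ (in the distributional sense). $\nabla_{\mathbb{H},y}=(Y_1,Y_2)$ is the same operator in the variable $y$: $Y_1=\partial_{y_1}+2y_2\partial_{y_3}$, $Y_2=\partial_{y_2}-2y_1\partial_{y_3}$.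 $H^1_{\mathbb{H}}(\Omega)=\{f\in L^2(\Omega): X_1f,X_2f\in L^2(\Omega)\}$. $Y=[0,2)^3$. For $k\in\mathbb{Z}^3$, $2k=(2k_1,2k_2,2k_3)$. A function $f$ on $\mathbb{H}^1$ is $Y$-periodic if $f(2k\cdot x)=f(x)$ for all $k\in\mathbb{Z}^3$ and all $x$. $L^2_{\#,\mathbb{H}}(Y)$ is the space of $Y$-periodic functions with $f|_Y\in L^2(Y)$. $H^1_{\#,\mathbb{H}}(Y)$ is the space of $f\in L^2_{\#,\mathbb{H}}(Y)$ such that $X_1f,X_2f\in L^2(\delta_\lambda(Y))$ for all $\lambda>0$, normed by $\|f\|_{L^2(Y)}$ and $\|X_if\|_{L^2(Y)}$; $/\mathbb{R}$ denotes the quotient by constants. *)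

theory Defs
  imports "HOL-Analysis.Analysis"
begin

type_synonym heis = "real ^ 3"

definition heis_mult :: "heis \<Rightarrow> heis \<Rightarrow> heis" (infixl \<open>\<cdot>\<^sub>H\<close> 70) where
  "p \<cdot>\<^sub>H q = vector [p $ 1 + q $ 1, p $ 2 + q $ 2,
                    p $ 3 + q $ 3 + 2 * (p $ 2 * q $ 1 - p $ 1 * q $ 2)]"

definition dil :: "real \<Rightarrow> heis \<Rightarrow> heis" where
  "dil l x = vector [l * x $ 1, l * x $ 2, l\<^sup>2 * x $ 3]"

definition Ycell :: "heis set" where
  "Ycell = {y. \<forall>i. 0 \<le> y $ i \<and> y $ i < 2}"

definition lattice_pt :: "int ^ 3 \<Rightarrow> heis" where
  "lattice_pt k = (\<chi> i. 2 * real_of_int (k $ i))"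

definition Yperiodic :: "(heis \<Rightarrow> 'a) \<Rightarrow> bool" where
  "Yperiodic f \<longleftrightarrow> (\<forall>k x. f (lattice_pt k \<cdot>\<^sub>H x) = f x)"

definition pd :: "3 \<Rightarrow> (heis \<Rightarrow> real) \<Rightarrow> heis \<Rightarrow> real" where
  "pd i f x = frechet_derivative f (at x) (axis i 1)"

primrec C_k :: "nat \<Rightarrow> (heis \<Rightarrow> real) \<Rightarrow> bool" where
  "C_k 0 f \<longleftrightarrow> continuous_on UNIV f"
| "C_k (Suc n) f \<longleftrightarrow> f differentiable_on UNIV \<and> (\<forall>i. C_k n (pd i f))"

definition test_functions :: "heis set \<Rightarrow> (heis \<Rightarrow> real) set" where
  "test_functions \<Omega> =
     {\<phi>. (\<forall>n. C_k n \<phi>) \<and> compact (closure {x. \<phi> x \<noteq> 0}) \<and> closure {x. \<phi> x \<noteq> 0} \<subseteq> \<Omega>}"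

definition hX :: "2 \<Rightarrow> (heis \<Rightarrow> real) \<Rightarrow> heis \<Rightarrow> real" where
  "hX i \<phi> x = (if i = 1 then pd 1 \<phi> x + 2 * x $ 2 * pd 3 \<phi> x
                        else pd 2 \<phi> x - 2 * x $ 1 * pd 3 \<phi> x)"

definition locally_integrable :: "heis set \<Rightarrow> (heis \<Rightarrow> real) \<Rightarrow> bool" where
  "locally_integrable \<Omega> f \<longleftrightarrow> (\<forall>K. compact K \<and> K \<subseteq> \<Omega> \<longrightarrow> f absolutely_integrable_on K)"

text \<open>The fields \<open>hX 1\<close> and \<open>hX 2\<close> are divergence-free, so their formal
  adjoints are \<open>- hX 1\<close> and \<open>- hX 2\<close>; this gives the sign in the distributional derivative.\<close>

definition is_weak_X :: "2 \<Rightarrow> heis set \<Rightarrow> (heis \<Rightarrow> real) \<Rightarrow> (heis \<Rightarrow> real) \<Rightarrow> bool" where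
  "is_weak_X i \<Omega> f g \<longleftrightarrow> locally_integrable \<Omega> f \<and> locally_integrable \<Omega> g \<and>
     (\<forall>\<phi>\<in>test_functions \<Omega>.
        (LINT x|lebesgue_on \<Omega>. f x * hX i \<phi> x) = - (LINT x|lebesgue_on \<Omega>. g x * \<phi> x))"

text \<open>\<open>wX i \<Omega> f\<close> is a representative of the distributional derivative, which is determined only
  up to null sets; it is meaningful only if \<open>is_weak_X i \<Omega> f\<close> is satisfied by some function.\<close>

definition wX :: "2 \<Rightarrow> heis set \<Rightarrow> (heis \<Rightarrow> real) \<Rightarrow> heis \<Rightarrow> real" where
  "wX i \<Omega> f = (SOME g. is_weak_X i \<Omega> f g)"

definition hgrad :: "heis set \<Rightarrow> (heis \<Rightarrow> real) \<Rightarrow> heis \<Rightarrow> real ^ 2" where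
  "hgrad \<Omega> f x = (\<chi> i. wX i \<Omega> f x)"

definition L2 :: "heis set \<Rightarrow> (heis \<Rightarrow> real) set" where
  "L2 \<Omega> = {f. f \<in> borel_measurable (lebesgue_on \<Omega>) \<and> integrable (lebesgue_on \<Omega>) (\<lambda>x. (f x)\<^sup>2)}"

definition H1 :: "heis set \<Rightarrow> (heis \<Rightarrow> real) set" where
  "H1 \<Omega> = {f \<in> L2 \<Omega>. \<forall>i. \<exists>g. is_weak_X i \<Omega> f g \<and> g \<in> L2 \<Omega>}"

definition L2per :: "(heis \<Rightarrow> real) set" where
  "L2per = {f. Yperiodic f \<and> f \<in> L2 Ycell}"

definition H1per :: "(heis \<Rightarrow> real) set" where
  "H1per = {f \<in> L2per. \<forall>i. \<exists>g. is_weak_X i UNIV f g \<and> (\<forall>l>0. g \<in> L2 (dil l ` Ycell))}"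

definition H1per_norm :: "(heis \<Rightarrow> real) \<Rightarrow> real" where
  "H1per_norm f = sqrt ((LINT y|lebesgue_on Ycell. (f y)\<^sup>2)
     + (\<Sum>i\<in>UNIV. LINT y|lebesgue_on Ycell. (wX i UNIV f y)\<^sup>2))"

text \<open>Elements of the quotient of \<open>H1per\<close> by the constants are handled through representatives
  in \<open>H1per\<close>: \<open>quot_eq\<close> is equality and \<open>quot_norm\<close> the norm in the quotient.\<close>

definition quot_eq :: "(heis \<Rightarrow> real) \<Rightarrow> (heis \<Rightarrow> real) \<Rightarrow> bool" where
  "quot_eq f g \<longleftrightarrow> (\<exists>c. AE y in lebesgue. f y = g y + c)"

definition quot_norm :: "(heis \<Rightarrow> real) \<Rightarrow> real" where
  "quot_norm f = (INF c. H1per_norm (\<lambda>y. f y + c))"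

text \<open>The Bochner space of square-integrable maps from \<open>\<Omega>\<close> to the quotient of \<open>H1per\<close> by the
  constants: strongly measurable (an almost everywhere limit, in the quotient norm, of simple
  functions) with square-integrable norm.\<close>

definition L2_H1per_quot :: "heis set \<Rightarrow> (heis \<Rightarrow> heis \<Rightarrow> real) set" where
  "L2_H1per_quot \<Omega> = {w.
     (\<forall>x\<in>\<Omega>. w x \<in> H1per) \<and>
     (\<exists>s :: nat \<Rightarrow> heis \<Rightarrow> heis \<Rightarrow> real.
        (\<forall>n. simple_function (lebesgue_on \<Omega>) (s n) \<and> s n ` \<Omega> \<subseteq> H1per) \<and>
        (AE x in lebesgue_on \<Omega>. (\<lambda>n. quot_norm (\<lambda>y. s n x y - w x y)) \<longlonglongrightarrow> 0)) \<and>
     integrable (lebesgue_on \<Omega>) (\<lambda>x. (quot_norm (w x))\<^sup>2)}"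

text \<open>Integrals over \<open>\<Omega> \<times> Ycell\<close> are iterated: the gradient in \<open>y\<close> of an element \<open>w\<close> of
  \<open>L2_H1per_quot \<Omega>\<close> is, for each \<open>x\<close>, the class of \<open>hgrad UNIV (w x)\<close> in the square-integrable
  fields on \<open>Ycell\<close>, so that the inner integral does not depend on the representatives.\<close>

definition two_scale_solution ::
  "heis set \<Rightarrow> (heis \<Rightarrow> real ^ 2 ^ 2) \<Rightarrow> (heis \<Rightarrow> real) \<Rightarrow> (heis \<Rightarrow> real) \<Rightarrow> (heis \<Rightarrow> heis \<Rightarrow> real) \<Rightarrow> bool" where
  "two_scale_solution \<Omega> A f u u1 \<longleftrightarrow> u \<in> H1 \<Omega> \<and> u1 \<in> L2_H1per_quot \<Omega> \<and>
     (\<forall>\<phi>\<in>H1 \<Omega>. \<forall>\<phi>1\<in>L2_H1per_quot \<Omega>.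
        (LINT x|lebesgue_on \<Omega>. LINT y|lebesgue_on Ycell.
           (A y *v (hgrad \<Omega> u x + hgrad UNIV (u1 x) y)) \<bullet> (hgrad \<Omega> \<phi> x + hgrad UNIV (\<phi>1 x) y))
        + (LINT x|lebesgue_on \<Omega>. LINT y|lebesgue_on Ycell. u x * \<phi> x)
        = (LINT x|lebesgue_on \<Omega>. LINT y|lebesgue_on Ycell. f x * \<phi> x))"

definition cell_solution :: "(heis \<Rightarrow> real ^ 2 ^ 2) \<Rightarrow> 2 \<Rightarrow> (heis \<Rightarrow> real) \<Rightarrow> bool" where
  "cell_solution A i Z \<longleftrightarrow> Z \<in> H1per \<and>
     (\<forall>\<xi>\<in>H1per.
        (LINT y|lebesgue_on Ycell. (A y *v hgrad UNIV Z y) \<bullet> hgrad UNIV \<xi> y)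
        = - (LINT y|lebesgue_on Ycell. (A y *v axis i 1) \<bullet> hgrad UNIV \<xi> y))"

definition effective_matrix :: "(heis \<Rightarrow> real ^ 2 ^ 2) \<Rightarrow> (2 \<Rightarrow> heis \<Rightarrow> real) \<Rightarrow> real ^ 2 ^ 2" where
  "effective_matrix A Z =
     (LINT y|lebesgue_on Ycell. A y ** (mat 1 + (\<chi> i j. wX i UNIV (Z j) y)))"

text \<open>Weak solutions of \<open>- div\<^sub>H (B \<nabla>\<^sub>H u) + c u = g\<close> in \<open>\<Omega>\<close> with homogeneous Neumann condition:
  the test functions range over all of \<open>H1 \<Omega>\<close>.\<close>

definition weak_neumann_solution ::
  "heis set \<Rightarrow> real ^ 2 ^ 2 \<Rightarrow> real \<Rightarrow> (heis \<Rightarrow> real) \<Rightarrow> (heis \<Rightarrow> real) \<Rightarrow> bool" where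
  "weak_neumann_solution \<Omega> B c g u \<longleftrightarrow> u \<in> H1 \<Omega> \<and>
     (\<forall>\<phi>\<in>H1 \<Omega>.
        (LINT x|lebesgue_on \<Omega>. (B *v hgrad \<Omega> u x) \<bullet> hgrad \<Omega> \<phi> x)
        + c * (LINT x|lebesgue_on \<Omega>. u x * \<phi> x)
        = (LINT x|lebesgue_on \<Omega>. g x * \<phi> x))"

end

theory Submission
  imports Defs "HOL-Computational_Algebra.Polynomial"
begin

text \<open>
  Put \<open>w = u\<^sub>1 - \<Sum>\<^sub>i Z\<^sub>i X\<^sub>i u\<close>, an admissible second component of a test pair. Testing the
  two-scale problem with \<open>(0, w)\<close> and using the cell problems with test function \<open>w x\<close>, all mixed
  terms cancel and the integral over \<open>\<Omega>\<close> of the energies of \<open>w x\<close> vanishes. By coercivity the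
  horizontal gradient of \<open>w x\<close> is zero on the cell for almost every \<open>x\<close>, and since \<open>X\<^sub>1\<close>, \<open>X\<^sub>2\<close>
  and their commutator \<open>-4 \<partial>\<^sub>3\<close> span all directions, \<open>w x\<close> is constant on the cell, hence
  everywhere by periodicity. Testing with \<open>(\<phi>, 0)\<close> and inserting this form of \<open>u\<^sub>1\<close> gives the
  effective equation.

  Weak derivatives are only chosen representatives, so each manipulation of them rests on their
  almost everywhere uniqueness; for this it suffices to test with products of functions of one
  variable. Because a Bochner integral of a non-integrable function is zero, the vanishing of the
  energies also needs the measurability of \<open>x \<mapsto> energy (w x)\<close>, which follows from the Lipschitz
  continuity of the square root of the energy in the quotient norm.
\<close>

subsection \<open>Smooth functions and tensor product test functions\<close>

text \<open>Products a(x_1) b(x_2) c(x_3) are closed under \<open>pd\<close> and under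
  multiplication by a coordinate, so \<open>hX\<close> maps them to sums of two such products. This
  turns the weak equations of a function with zero gradient into linear algebra of a trilinear
  pairing: the commutator is a combination of four of these equations, and the step from vanishing
  derivatives to a constant is the du Bois-Reymond argument, one variable at a time, without
  mollification. The gradient is known to vanish only on the half-open cell; all testing therefore
  happens in its interior, and only the resulting constant is carried to the whole space by lattice
  translations. In \<open>x\<close> the obstacle is that \<open>hgrad UNIV (w x)\<close> is picked
  by choice for each \<open>x\<close> separately, so nothing is known about joint measurability in
  \<open>(x, y)\<close>. The dependence on \<open>x\<close> is controlled only through real
  functionals on the quotient, and changes of an integrand on null sets are justified without
  measurability by \<open>integral_lebesgue_on_cong_AE\<close>.\<close>

primrec times_differentiable :: "nat \<Rightarrow> (real \<Rightarrow> real) \<Rightarrow> bool" where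
  "times_differentiable 0 f \<longleftrightarrow> True"
| "times_differentiable (Suc n) f \<longleftrightarrow>
     (\<forall>x. f field_differentiable at x) \<and> times_differentiable n (deriv f)"

definition smooth1 :: "(real \<Rightarrow> real) \<Rightarrow> bool" where
  "smooth1 f \<longleftrightarrow> (\<forall>n. times_differentiable n f)"

lemma times_differentiable_Suc_I:
  assumes "\<And>x. (f has_real_derivative f' x) (at x)" "times_differentiable n f'"
  shows "times_differentiable (Suc n) f"
proof -
  have "deriv f = f'" using assms(1) by (auto intro: DERIV_imp_deriv)
  then show ?thesis using assms by (auto simp: field_differentiable_def)
qed

lemma times_differentiable_SucD: "times_differentiable (Suc n) f \<Longrightarrow> times_differentiable n f"
  by (induction n arbitrary: f) auto

lemma times_differentiable_SucE:
  assumes "times_differentiable (Suc n) f"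
  shows "(f has_real_derivative deriv f x) (at x)" "times_differentiable n (deriv f)"
  using assms by (auto simp: field_differentiable_derivI)

lemma times_differentiable_const: "times_differentiable n (\<lambda>x. c)"
proof (induction n arbitrary: c)
  case (Suc n)
  show ?case by (rule times_differentiable_Suc_I[OF _ Suc[of 0]]) simp
qed simp

lemma times_differentiable_ident: "times_differentiable n (\<lambda>x. x)"
proof (cases n)
  case (Suc m)
  show ?thesis unfolding Suc
    by (rule times_differentiable_Suc_I[OF _ times_differentiable_const[of m 1]]) simp
qed simp

lemma times_differentiable_add:
  "times_differentiable n f \<Longrightarrow> times_differentiable n g \<Longrightarrow> times_differentiable n (\<lambda>x. f x + g x)"
proof (induction n arbitrary: f g)
  case (Suc n)
  show ?case
    by (rule times_differentiable_Suc_I[OF DERIV_add])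
      (use Suc times_differentiable_SucE in blast)+
qed simp

lemma times_differentiable_mult:
  "times_differentiable n f \<Longrightarrow> times_differentiable n g \<Longrightarrow> times_differentiable n (\<lambda>x. f x * g x)"
proof (induction n arbitrary: f g)
  case (Suc n)
  have "times_differentiable n (\<lambda>x. deriv f x * g x + deriv g x * f x)"
    by (intro times_differentiable_add Suc.IH)
      (use Suc.prems times_differentiable_SucE times_differentiable_SucD in blast)+
  then show ?case
    by (rule times_differentiable_Suc_I[OF DERIV_mult[OF times_differentiable_SucE(1)[OF Suc.prems(1)]
            times_differentiable_SucE(1)[OF Suc.prems(2)]]])
qed simp

lemma times_differentiable_affine:
  "times_differentiable n f \<Longrightarrow> times_differentiable n (\<lambda>x. f (m * x + b))"
proof (induction n arbitrary: f)
  case (Suc n)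
  have "times_differentiable n (\<lambda>x. deriv f (m * x + b) * m)"
    by (intro times_differentiable_mult times_differentiable_const Suc.IH times_differentiable_SucE(2)[OF Suc.prems])
  moreover have "((\<lambda>x. f (m * x + b)) has_real_derivative deriv f (m * x + b) * m) (at x)" for x
    by (rule DERIV_chain2[OF times_differentiable_SucE(1)[OF Suc.prems]]) (auto intro!: derivative_eq_intros)
  ultimately show ?case by (rule times_differentiable_Suc_I[rotated])
qed simp

lemma smooth1_const: "smooth1 (\<lambda>x. c)"
  and smooth1_ident: "smooth1 (\<lambda>x. x)"
  and smooth1_add: "smooth1 f \<Longrightarrow> smooth1 g \<Longrightarrow> smooth1 (\<lambda>x. f x + g x)"
  and smooth1_mult: "smooth1 f \<Longrightarrow> smooth1 g \<Longrightarrow> smooth1 (\<lambda>x. f x * g x)"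
  and smooth1_affine: "smooth1 f \<Longrightarrow> smooth1 (\<lambda>x. f (m * x + b))"
  by (auto simp: smooth1_def times_differentiable_const times_differentiable_ident
      times_differentiable_add times_differentiable_mult times_differentiable_affine)

lemma smooth1_DERIV: "smooth1 f \<Longrightarrow> (f has_real_derivative deriv f x) (at x)"
  unfolding smooth1_def using times_differentiable_SucE(1) by blast

lemma smooth1_deriv: "smooth1 f \<Longrightarrow> smooth1 (deriv f)"
  unfolding smooth1_def using times_differentiable_SucE(2) by blast

lemma smooth1_continuous: "smooth1 f \<Longrightarrow> continuous_on S f"
  by (rule DERIV_continuous_on) (blast intro: smooth1_DERIV has_field_derivative_at_within)

text \<open>Beyond the first order, the derivatives of \<open>f\<close> are those of
  \<open>f'\<close>, so a primitive without closed formula is still smooth. One order is spent on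
  \<open>f\<close> itself, hence \<open>n - 1\<close>.\<close>

lemma smooth1_antiderivative:
  assumes "\<And>x. (f has_real_derivative f' x) (at x)" "smooth1 f'"
  shows "smooth1 f"
  unfolding smooth1_def
proof
  fix n show "times_differentiable n f"
    using times_differentiable_Suc_I[of f f' "n - 1"] assms
    by (cases n) (auto simp: smooth1_def simp del: times_differentiable.simps(2))
qed

text \<open>The family \<open>p(1/x) exp(-1/x)\<close>, extended by zero to \<open>x \<le> 0\<close>, is closed under differentiation.\<close>

definition flat_fun :: "real poly \<Rightarrow> real \<Rightarrow> real" where
  "flat_fun p x = (if x > 0 then poly p (1 / x) * exp (- (1 / x)) else 0)"

lemma poly_times_exp_minus_tendsto_0: "((\<lambda>s. poly p s * exp (- s)) \<longlongrightarrow> 0) at_top" for p :: "real poly"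
proof -
  have "((\<lambda>s. \<Sum>i\<le>degree p. coeff p i * (s ^ i / exp s)) \<longlongrightarrow> (\<Sum>i\<le>degree p. coeff p i * 0)) at_top"
    by (intro tendsto_intros tendsto_power_div_exp_0)
  then show ?thesis
    by (simp add: poly_altdef exp_minus sum_divide_distrib divide_inverse sum_distrib_right mult.assoc)
qed

text \<open>With s = 1/x, differentiating p(s) exp(-s) in x gives s^2 (p(s) - p'(s)) exp(-s), and
  \<open>[:0, 0, 1:]\<close> is the polynomial s^2. At the origin both one-sided difference
  quotients tend to 0, the value of every \<open>flat_fun\<close> there.\<close>

lemma flat_fun_DERIV:
  "(flat_fun p has_real_derivative flat_fun ([:0, 0, 1:] * (p - pderiv p)) x) (at x)"
proof -
  consider "x > 0" | "x < 0" | "x = 0" by linarith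
  then show ?thesis
  proof cases
    case 1
    have "((\<lambda>x. poly p (1 / x) * exp (- (1 / x))) has_real_derivative
        flat_fun ([:0, 0, 1:] * (p - pderiv p)) x) (at x)"
      using 1 by (auto intro!: derivative_eq_intros DERIV_chain2[OF poly_DERIV]
          simp: flat_fun_def field_simps power2_eq_square)
    then show ?thesis
      by (rule DERIV_cong_ev[OF refl _ refl, THEN iffD1, rotated])
        (use 1 in \<open>auto simp: flat_fun_def intro: eventually_mono[OF eventually_nhds_in_open[of "{0<..}"]]\<close>)
  next
    case 2
    have "((\<lambda>x. 0) has_real_derivative flat_fun ([:0, 0, 1:] * (p - pderiv p)) x) (at x)"
      using 2 by (simp add: flat_fun_def)
    then show ?thesis
      by (rule DERIV_cong_ev[OF refl _ refl, THEN iffD1, rotated])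
        (use 2 in \<open>auto simp: flat_fun_def intro: eventually_mono[OF eventually_nhds_in_open[of "{..<0}"]]\<close>)
  next
    case 3
    \<comment> \<open>The right difference quotient is s p(s) exp(-s) with s = 1/h;
      \<open>pCons 0 p\<close> absorbs the additional factor s.\<close>
    have "((\<lambda>x. poly (pCons 0 p) (1 / x) * exp (- (1 / x))) \<longlongrightarrow> 0) (at_right (0::real))"
      using filterlim_compose[OF poly_times_exp_minus_tendsto_0[of "pCons 0 p"] filterlim_inverse_at_top_right]
      by (simp add: inverse_eq_divide)
    then have "((\<lambda>h. (flat_fun p (0 + h) - flat_fun p 0) / h) \<longlongrightarrow> 0) (at_right 0)"
      by (rule Lim_transform_eventually)
        (auto simp: flat_fun_def eventually_at_right_less intro!: eventually_mono[OF eventually_at_right_less])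
    moreover have "((\<lambda>h. (flat_fun p (0 + h) - flat_fun p 0) / h) \<longlongrightarrow> 0) (at_left 0)"
      by (rule Lim_transform_eventually[OF tendsto_const])
        (auto simp: flat_fun_def eventually_at_left_field intro!: exI[of _ "-1"])
    ultimately have "((\<lambda>h. (flat_fun p (0 + h) - flat_fun p 0) / h) \<longlongrightarrow> 0) (at 0)"
      by (simp add: filterlim_split_at)
    then show ?thesis using 3 by (simp add: DERIV_def flat_fun_def)
  qed
qed

lemma smooth1_flat_fun: "smooth1 (flat_fun p)"
  unfolding smooth1_def
proof
  fix n show "times_differentiable n (flat_fun p)"
  proof (induction n arbitrary: p)
    case (Suc n)
    show ?case by (rule times_differentiable_Suc_I[OF flat_fun_DERIV Suc])
  qed simp
qed

text \<open>The factor \<open>n\<close> steepens both flanks without moving the support: at a fixed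
  point of the open interval both exponents tend to 0, so the bumps converge to the
  indicator.\<close>

definition bump :: "nat \<Rightarrow> real \<Rightarrow> real \<Rightarrow> real \<Rightarrow> real" where
  "bump n p q x = flat_fun 1 (real n * (x - p)) * flat_fun 1 (real n * (q - x))"

lemma smooth1_bump: "smooth1 (bump n p q)"
proof -
  have "smooth1 (\<lambda>x. flat_fun 1 (real n * x + (- real n * p)) * flat_fun 1 ((- real n) * x + real n * q))"
    by (intro smooth1_mult smooth1_affine smooth1_flat_fun)
  then show ?thesis by (simp add: bump_def[abs_def] algebra_simps)
qed

lemma bump_nonneg: "0 \<le> bump n p q x" and bump_le_1: "bump n p q x \<le> 1"
  by (auto simp: bump_def flat_fun_def mult_le_one)

lemma bump_pos: "n > 0 \<Longrightarrow> p < x \<Longrightarrow> x < q \<Longrightarrow> 0 < bump n p q x"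
  by (auto simp: bump_def flat_fun_def)

lemma bump_eq_0: "x \<notin> {p<..<q} \<Longrightarrow> bump n p q x = 0"
proof -
  assume "x \<notin> {p<..<q}"
  then have "real n * (x - p) \<le> 0 \<or> real n * (q - x) \<le> 0"
    by (auto simp: mult_le_0_iff)
  then show ?thesis by (auto simp: bump_def flat_fun_def)
qed

lemma flat_fun_1_tendsto_1:
  assumes "y > 0" shows "(\<lambda>n. flat_fun 1 (real n * y)) \<longlonglongrightarrow> 1"
proof -
  have "(\<lambda>n. exp (- (inverse (real n) * (1 / y)))) \<longlonglongrightarrow> exp (- (0 * (1 / y)))"
    by (intro tendsto_intros lim_inverse_n)
  then have "(\<lambda>n. exp (- (inverse (real n) * (1 / y)))) \<longlonglongrightarrow> 1" by simp
  then show ?thesis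
    by (rule Lim_transform_eventually)
      (use assms in \<open>auto simp: flat_fun_def field_simps intro!: eventually_mono[OF eventually_gt_at_top[of 0]]\<close>)
qed

lemma bump_tendsto_indicator: "(\<lambda>n. bump n p q x) \<longlonglongrightarrow> indicator {p<..<q} x"
proof (cases "x \<in> {p<..<q}")
  case True
  then show ?thesis unfolding bump_def
    using tendsto_mult[OF flat_fun_1_tendsto_1[of "x - p"] flat_fun_1_tendsto_1[of "q - x"]] by simp
qed (simp add: bump_eq_0)

section \<open>Products of three one-variable functions\<close>

definition tensor :: "(real \<Rightarrow> real) \<Rightarrow> (real \<Rightarrow> real) \<Rightarrow> (real \<Rightarrow> real) \<Rightarrow> heis \<Rightarrow> real" where
  "tensor a b c x = a (x $ 1) * b (x $ 2) * c (x $ 3)"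

lemma tensor_has_derivative:
  assumes "smooth1 a" "smooth1 b" "smooth1 c"
  shows "(tensor a b c has_derivative (\<lambda>h. tensor (deriv a) b c x * h $ 1
     + tensor a (deriv b) c x * h $ 2 + tensor a b (deriv c) x * h $ 3)) (at x)"
proof -
  have D: "((\<lambda>x. f (x $ i)) has_derivative (\<lambda>h. deriv f (x $ i) * h $ i)) (at x)"
    if "smooth1 f" for f and i :: 3
    using has_derivative_compose[OF bounded_linear_imp_has_derivative[OF bounded_linear_vec_nth]
        smooth1_DERIV[OF that, unfolded has_field_derivative_def]] .
  show ?thesis unfolding tensor_def[abs_def]
    by (rule has_derivative_eq_rhs[OF has_derivative_mult[OF has_derivative_mult[OF D[OF assms(1)] D[OF assms(2)]] D[OF assms(3)]]])
      (auto simp: algebra_simps)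
qed

lemma pd_tensor:
  assumes "smooth1 a" "smooth1 b" "smooth1 c"
  shows "pd 1 (tensor a b c) = tensor (deriv a) b c"
    "pd 2 (tensor a b c) = tensor a (deriv b) c"
    "pd 3 (tensor a b c) = tensor a b (deriv c)"
  unfolding pd_def fun_eq_iff frechet_derivative_at[OF tensor_has_derivative[OF assms], symmetric]
  by (simp_all add: axis_def)

lemma C_k_tensor: "smooth1 a \<Longrightarrow> smooth1 b \<Longrightarrow> smooth1 c \<Longrightarrow> C_k n (tensor a b c)"
proof (induction n arbitrary: a b c)
  case 0
  have "continuous_on UNIV (\<lambda>x::heis. f (x $ i))" if "smooth1 f" for f i
    by (rule continuous_on_compose2[OF smooth1_continuous[OF that, of UNIV]]) (auto intro!: continuous_intros)
  with 0 show ?case by (simp add: tensor_def[abs_def] continuous_on_mult)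
next
  case (Suc n)
  have "tensor a b c differentiable_on UNIV"
    using tensor_has_derivative[OF Suc.prems]
    by (auto simp: differentiable_on_def differentiable_def)
  moreover have "C_k n (pd i (tensor a b c))" for i
    using exhaust_3[of i] Suc by (auto simp: pd_tensor smooth1_deriv)
  ultimately show ?case by simp
qed

lemma tensor_support:
  assumes "\<And>t. t \<notin> {p$1..q$1} \<Longrightarrow> a t = 0" "\<And>t. t \<notin> {p$2..q$2} \<Longrightarrow> b t = 0" "\<And>t. t \<notin> {p$3..q$3} \<Longrightarrow> c t = 0"
    "x \<notin> cbox p q"
  shows "tensor a b c x = 0"
  using assms(4) assms(1)[of "x$1"] assms(2)[of "x$2"] assms(3)[of "x$3"]
  by (auto simp: mem_box_cart forall_3 tensor_def)

lemma tensor_in_test_functions: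
  assumes "smooth1 a" "smooth1 b" "smooth1 c"
    and supp: "\<And>x. x \<notin> K \<Longrightarrow> tensor a b c x = 0" and K: "compact K" "K \<subseteq> \<Omega>"
  shows "tensor a b c \<in> test_functions \<Omega>"
proof -
  have "closure {x. tensor a b c x \<noteq> 0} \<subseteq> K"
    by (rule closure_minimal) (use supp K compact_imp_closed in auto)
  moreover from this have "compact (closure {x. tensor a b c x \<noteq> 0})"
    using K(1) by (meson bounded_subset closed_closure compact_eq_bounded_closed)
  ultimately show ?thesis unfolding test_functions_def
    using assms(1-3) K by (auto simp: C_k_tensor)
qed

text \<open>The coefficients \<open>x $ 2\<close> and \<open>x $ 1\<close> of the fields are
  absorbed into the factor of their own variable, so the result stays within the class.\<close>

lemma hX_tensor:
  assumes "smooth1 a" "smooth1 b" "smooth1 c"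
  shows "hX 1 (tensor a b c) x = tensor (deriv a) b c x + 2 * tensor a (\<lambda>t. t * b t) (deriv c) x"
    "hX 2 (tensor a b c) x = tensor a (deriv b) c x - 2 * tensor (\<lambda>t. t * a t) b (deriv c) x"
  using assms by (simp_all add: hX_def pd_tensor) (simp_all add: tensor_def)

subsection \<open>The fundamental lemma of the calculus of variations\<close>

text \<open>Open boxes form an intersection-stable generator of the Borel sets, and the sets over
  which \<open>g\<close> integrates to zero form a Dynkin system. Closure under complements requires
  the total integral to vanish, which the support in a box provides. Uniqueness of densities then
  compares \<open>g\<close> with 0.\<close>

lemma lborel_AE_zero_of_box_integrals:
  fixes g :: "'a::euclidean_space \<Rightarrow> real"
  assumes g: "integrable lborel g" and supp: "\<And>x. x \<notin> box p q \<Longrightarrow> g x = 0"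
    and zero: "\<And>a b. (LINT x|lborel. indicator (box a b) x * g x) = 0"
  shows "AE x in lborel. g x = 0"
proof (rule density_unique_real[OF g integrable_zero])
  have int: "set_integrable lborel A g" if "A \<in> sets borel" for A
    unfolding set_integrable_def by (rule integrable_mult_indicator) (use that g in auto)
  have total: "(LINT x|lborel. g x) = 0"
  proof -
    have "(\<lambda>x. indicator (box p q) x * g x) = g" using supp by (force simp: indicator_def)
    with zero[of p q] show ?thesis by simp
  qed
  fix A :: "'a set" assume "A \<in> sets lborel"
  then have A: "A \<in> sigma_sets UNIV (range (\<lambda>(a, b). box a b :: 'a set))"
    by (simp add: borel_eq_box)
  have st: "Int_stable (range (\<lambda>(a, b). box a b :: 'a set))"
  proof (rule Int_stableI, clarify)
    fix a b a' b' :: 'a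
    show "box a b \<inter> box a' b' \<in> range (\<lambda>(a, b). box a b)"
      unfolding box_Int_box by (rule range_eqI, rule case_prod_conv[symmetric])
  qed
  have "range (\<lambda>(a, b). box a b :: 'a set) \<subseteq> Pow UNIV" by simp
  from st this A have "set_lebesgue_integral lborel A g = 0"
  proof (induction A rule: sigma_sets_induct_disjoint)
    case (basic A)
    then show ?case using zero by (auto simp: set_lebesgue_integral_def)
  next
    case empty
    then show ?case by (simp add: set_lebesgue_integral_def)
  next
    case (compl A)
    then have A: "A \<in> sets borel" by (simp add: borel_eq_box)
    have "set_lebesgue_integral lborel (A \<union> (UNIV - A)) g
        = set_lebesgue_integral lborel A g + set_lebesgue_integral lborel (UNIV - A) g"
      by (rule set_integral_Un) (use A in \<open>auto intro!: int\<close>)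
    then show ?case using compl total by (simp add: set_lebesgue_integral_def)
  next
    case (union A)
    then have A: "A i \<in> sets borel" for i by (auto simp: borel_eq_box)
    have "set_lebesgue_integral lborel (\<Union>i. A i) g = (\<Sum>i. set_lebesgue_integral lborel (A i) g)"
      by (rule lebesgue_integral_countable_add) (use A union in \<open>auto intro!: int simp: disjoint_family_on_def\<close>)
    then show ?case using union by simp
  qed
  then show "set_lebesgue_integral lborel A g = (LINT x:A|lborel. 0)"
    by (simp add: set_lebesgue_integral_def)
qed

definition bump_box :: "nat \<Rightarrow> heis \<Rightarrow> heis \<Rightarrow> heis \<Rightarrow> real" where
  "bump_box n p q = tensor (bump n (p$1) (q$1)) (bump n (p$2) (q$2)) (bump n (p$3) (q$3))"

lemma bump_box_eq_0: "x \<notin> box p q \<Longrightarrow> bump_box n p q x = 0"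
  by (auto simp: bump_box_def tensor_def mem_box_cart forall_3 bump_eq_0)

lemma bump_box_nonneg: "0 \<le> bump_box n p q x" and bump_box_le_1: "bump_box n p q x \<le> 1"
  by (auto simp: bump_box_def tensor_def intro!: mult_nonneg_nonneg mult_le_one bump_nonneg bump_le_1)

lemma bump_box_tendsto_indicator: "(\<lambda>n. bump_box n p q x) \<longlonglongrightarrow> indicator (box p q) x"
proof -
  have "indicator (box p q) x
      = (indicator {p$1<..<q$1} (x$1) * indicator {p$2<..<q$2} (x$2) * indicator {p$3<..<q$3} (x$3) :: real)"
    by (auto simp: indicator_def mem_box_cart forall_3)
  then show ?thesis unfolding bump_box_def tensor_def
    by (simp only:) (intro tendsto_mult bump_tendsto_indicator)
qed

lemma bump_box_test_function:
  assumes "cbox p q \<subseteq> \<Omega>" shows "bump_box n p q \<in> test_functions \<Omega>"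
  unfolding bump_box_def
  by (rule tensor_in_test_functions[OF smooth1_bump smooth1_bump smooth1_bump _ compact_cbox assms])
    (use bump_box_eq_0 box_subset_cbox in \<open>fastforce simp: bump_box_def\<close>)

lemma continuous_bump_box: "continuous_on UNIV (bump_box n p q)"
  using C_k_tensor[OF smooth1_bump smooth1_bump smooth1_bump, of 0] by (simp add: bump_box_def)

lemma borel_measurable_continuous_UNIV:
  "continuous_on UNIV (f :: heis \<Rightarrow> real) \<Longrightarrow> f \<in> borel_measurable lebesgue"
  by (intro measurable_completion) (simp add: borel_measurable_continuous_onI)

lemma locally_integrableD: "locally_integrable \<Omega> g \<Longrightarrow> compact K \<Longrightarrow> K \<subseteq> \<Omega> \<Longrightarrow> integrable lebesgue (\<lambda>x. indicator K x * g x)"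
  by (auto simp: locally_integrable_def set_integrable_def)

text \<open>Letting the bumps steepen gives vanishing integrals over every open box whose closed box
  lies in \<open>\<Omega>\<close>. Locally \<open>g\<close> is then replaced by a Borel function,
  because the Dynkin argument runs in \<open>lborel\<close>, and countably many closed boxes exhaust
  \<open>\<Omega>\<close>.\<close>

lemma AE_zero_of_bump_box_integrals:
  assumes "open \<Omega>" and g: "locally_integrable \<Omega> g"
    and zero: "\<And>n p q. cbox p q \<subseteq> \<Omega> \<Longrightarrow> (LINT x|lebesgue_on \<Omega>. g x * bump_box n p q x) = 0"
  shows "AE x in lebesgue_on \<Omega>. g x = 0"
proof -
  have Om: "\<Omega> \<in> sets lebesgue" using \<open>open \<Omega>\<close> by simp
  have box_zero: "(LINT x|lebesgue. indicator (box p q) x * g x) = 0" if "cbox p q \<subseteq> \<Omega>" for p q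
  proof (rule LIMSEQ_unique)
    have int: "integrable lebesgue (\<lambda>x. indicator (cbox p q) x * g x)"
      by (rule locally_integrableD[OF g compact_cbox that])
    have eq: "indicator (box p q) x * g x = (indicator (cbox p q) x * g x) * indicator (box p q) x"
      "indicator \<Omega> x * (g x * bump_box n p q x) = (indicator (cbox p q) x * g x) * bump_box n p q x" for x n
    proof -
      have "x \<in> box p q \<Longrightarrow> x \<in> cbox p q" "x \<in> cbox p q \<Longrightarrow> x \<in> \<Omega>"
        using that box_subset_cbox[of p q] by auto
      then show "indicator (box p q) x * g x = (indicator (cbox p q) x * g x) * indicator (box p q) x"
        "indicator \<Omega> x * (g x * bump_box n p q x) = (indicator (cbox p q) x * g x) * bump_box n p q x"
        by (cases "x \<in> box p q"; simp add: bump_box_eq_0)+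
    qed
    have "(\<lambda>n. LINT x|lebesgue. (indicator (cbox p q) x * g x) * bump_box n p q x)
        \<longlonglongrightarrow> (LINT x|lebesgue. (indicator (cbox p q) x * g x) * indicator (box p q) x)"
    proof (rule integral_dominated_convergence[where w="\<lambda>x. norm (indicator (cbox p q) x * g x)"])
      show "AE x in lebesgue. (\<lambda>n. indicator (cbox p q) x * g x * bump_box n p q x)
            \<longlonglongrightarrow> indicator (cbox p q) x * g x * indicator (box p q) x"
        by (intro AE_I2 tendsto_mult tendsto_const bump_box_tendsto_indicator)
      show "(\<lambda>x. indicator (cbox p q) x * g x * bump_box n p q x) \<in> borel_measurable lebesgue" for n
        by (intro borel_measurable_times borel_measurable_integrable[OF int]
            borel_measurable_continuous_UNIV continuous_bump_box)
      show "(\<lambda>x. indicator (cbox p q) x * g x * indicat_real (box p q) x) \<in> borel_measurable lebesgue"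
        by (intro borel_measurable_times borel_measurable_integrable[OF int] borel_measurable_indicator) auto
      show "AE x in lebesgue. norm (indicator (cbox p q) x * g x * bump_box n p q x)
          \<le> norm (indicator (cbox p q) x * g x)" for n
        by (intro AE_I2) (auto simp: abs_mult bump_box_nonneg bump_box_le_1 mult_left_le)
    qed (use int in auto)
    then show "(\<lambda>n. LINT x|lebesgue_on \<Omega>. g x * bump_box n p q x)
       \<longlonglongrightarrow> (LINT x|lebesgue. indicator (box p q) x * g x)"
      unfolding eq(1)
      by (subst integral_restrict_space) (use Om in \<open>simp_all add: eq(2)\<close>)
    show "(\<lambda>n. LINT x|lebesgue_on \<Omega>. g x * bump_box n p q x) \<longlonglongrightarrow> 0"
      using zero[OF that] by simp
  qed
  have box_AE: "AE x in lebesgue. x \<in> cbox p q \<longrightarrow> g x = 0" if "cbox p q \<subseteq> \<Omega>" for p q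
  proof -
    have "integrable lebesgue (\<lambda>x. indicator (box p q) x *\<^sub>R (indicator (cbox p q) x * g x))"
      by (rule integrable_mult_indicator[OF _ locally_integrableD[OF g compact_cbox that]]) simp
    moreover have "(\<lambda>x. indicator (box p q) x *\<^sub>R (indicator (cbox p q) x * g x)) = (\<lambda>x. indicator (box p q) x * g x)"
      using box_subset_cbox[of p q] by (fastforce simp: indicator_def)
    ultimately have int: "integrable lebesgue (\<lambda>x. indicator (box p q) x * g x)" by simp
    from completion_ex_borel_measurable_real[OF borel_measurable_integrable[OF this]]
    obtain h0 where h0: "h0 \<in> borel_measurable lborel" and h0_eq: "AE x in lborel. indicator (box p q) x * g x = h0 x"
      by auto
    \<comment> \<open>\<open>h0\<close> agrees with the localised \<open>g\<close> only almost
      everywhere; the indicator restores exact vanishing outside the box.\<close>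
    define h where "h x = indicator (box p q) x * h0 x" for x
    have h: "h \<in> borel_measurable lborel" unfolding h_def using h0 by measurable
    have h_eq: "AE x in lborel. h x = indicator (box p q) x * g x"
      using h0_eq by eventually_elim (auto simp: h_def indicator_def)
    have h_eq': "AE x in lebesgue. indicator (box p q) x * g x = h x"
      using AE_completion[OF h_eq] by eventually_elim simp
    have "integrable lebesgue h"
      by (rule integrable_cong_AE_imp[OF int measurable_completion[OF h] h_eq'])
    then have hint: "integrable lborel h" using integrable_completion[OF h] by simp
    have "AE x in lborel. h x = 0"
    proof (rule lborel_AE_zero_of_box_integrals[OF hint, of p q])
      fix a b :: heis
      \<comment> \<open>The two open boxes intersect in an open box whose closed counterpart stays
        inside \<open>cbox p q\<close>, so \<open>box_zero\<close> applies to it.\<close>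
      define p' q' where "p' = (\<chi> i. max (p$i) (a$i))" and "q' = (\<chi> i. min (q$i) (b$i))"
      have sub: "cbox p' q' \<subseteq> \<Omega>" using that by (auto simp: p'_def q'_def mem_box_cart subset_eq)
      have bx: "box a b \<inter> box p q = box p' q'" by (auto simp: p'_def q'_def mem_box_cart)
      have "(LINT x|lborel. indicator (box a b) x * h x) = (LINT x|lebesgue. indicator (box a b) x * h x)"
        by (rule integral_completion[symmetric]) (use h in measurable)
      also have "\<dots> = (LINT x|lebesgue. indicator (box p' q') x * g x)"
      proof (rule integral_cong_AE)
        show "AE x in lebesgue. indicator (box a b) x * h x = indicator (box p' q') x * g x"
          using h_eq' by eventually_elim (auto simp: bx[symmetric] indicator_def split: if_splits)
        show "(\<lambda>x. indicator (box a b) x * h x) \<in> borel_measurable lebesgue"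
          by (rule measurable_completion) (use h in measurable)
        have "(\<lambda>x. indicator (box a b) x * (indicator (box p q) x * g x)) \<in> borel_measurable lebesgue"
          by (intro borel_measurable_times borel_measurable_integrable[OF int] borel_measurable_indicator) auto
        moreover have "(\<lambda>x. indicator (box a b) x * (indicator (box p q) x * g x)) = (\<lambda>x. indicator (box p' q') x * g x)"
          by (auto simp: bx[symmetric] indicator_def)
        ultimately show "(\<lambda>x. indicator (box p' q') x * g x) \<in> borel_measurable lebesgue" by simp
      qed
      finally show "(LINT x|lborel. indicator (box a b) x * h x) = 0" using box_zero[OF sub] by simp
    qed (simp add: h_def)
    from AE_completion[OF this] h_eq'
    have "AE x in lebesgue. x \<in> box p q \<longrightarrow> g x = 0"
      by eventually_elim (auto simp: indicator_def)
    moreover have "AE x in lebesgue. x \<notin> cbox p q - box p q"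
      by (rule AE_not_in) (simp add: negligible_iff_null_sets[symmetric] negligible_frontier_interval)
    ultimately show ?thesis by eventually_elim auto
  qed
  obtain D where D: "countable D" "D \<subseteq> Pow \<Omega>" "\<And>X. X \<in> D \<Longrightarrow> \<exists>a b. X = cbox a b" "\<Union>D = \<Omega>"
    by (rule open_countable_Union_open_cbox[OF \<open>open \<Omega>\<close>]) (rule that; simp)
  have "AE x in lebesgue. x \<in> X \<longrightarrow> g x = 0" if X: "X \<in> D" for X
  proof -
    obtain a b where "X = cbox a b" using D(3)[OF X] by blast
    then show ?thesis using box_AE[of a b] D(2) X by blast
  qed
  then have "AE x in lebesgue. \<forall>X\<in>D. x \<in> X \<longrightarrow> g x = 0"
    by (subst AE_ball_countable[OF D(1)]) blast
  then have "AE x in lebesgue. x \<in> \<Omega> \<longrightarrow> g x = 0"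
    by eventually_elim (use D(4) in auto)
  then show ?thesis using Om by (simp add: AE_restrict_space_iff)
qed

subsection \<open>Weak horizontal derivatives\<close>

lemma pd_eqI: "(f has_derivative f') (at x) \<Longrightarrow> pd i f x = f' (axis i 1)"
  by (simp add: pd_def frechet_derivative_at[symmetric])

lemma pd_DERIV:
  assumes "f differentiable_on UNIV"
  shows "((\<lambda>s. f (x + s *\<^sub>R axis i 1)) has_real_derivative pd i f (x + s *\<^sub>R axis i 1)) (at s)"
proof -
  let ?D = "frechet_derivative f (at (x + s *\<^sub>R axis i 1))"
  have D: "(f has_derivative ?D) (at (x + s *\<^sub>R axis i 1))"
    using assms by (simp add: differentiable_on_def frechet_derivative_works)
  have "((\<lambda>s. x + s *\<^sub>R axis i 1) has_derivative (\<lambda>h. h *\<^sub>R axis i 1)) (at s)"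
    by (auto intro!: derivative_eq_intros)
  from has_derivative_compose[OF this D] show ?thesis
    by (simp add: has_field_derivative_def pd_def linear_cmul[OF has_derivative_linear[OF D]] mult_commute_abs)
qed

lemma pd_eq_0_outside:
  assumes "closed K" "\<And>x. x \<notin> K \<Longrightarrow> f x = 0" "x \<notin> K"
  shows "pd i f x = 0"
proof -
  have "(f has_derivative (\<lambda>h. 0)) (at x)"
    by (rule has_derivative_transform_within_open[of "\<lambda>x. 0" _ _ UNIV "- K"]) (use assms in auto)
  from pd_eqI[OF this] show ?thesis .
qed

lemma continuous_compact_support_bounded:
  fixes f :: "heis \<Rightarrow> real"
  assumes "continuous_on UNIV f" "compact K" "\<And>x. x \<notin> K \<Longrightarrow> f x = 0"
  obtains M where "M > 0" "\<And>x. \<bar>f x\<bar> \<le> M"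
proof -
  have "bounded (f ` K)"
    using compact_continuous_image[OF continuous_on_subset[OF assms(1)] assms(2)] compact_imp_bounded by blast
  then obtain M where M: "M > 0" "\<And>x. x \<in> K \<Longrightarrow> \<bar>f x\<bar> \<le> M" by (auto simp: bounded_pos)
  have "\<bar>f x\<bar> \<le> M" for x
    by (cases "x \<in> K") (use M assms(3)[of x] in auto)
  with M(1) show thesis by (rule that)
qed

lemma integrable_bounded_compact_support:
  fixes f :: "heis \<Rightarrow> real"
  assumes "f \<in> borel_measurable borel" "compact K" "\<And>x. x \<notin> K \<Longrightarrow> f x = 0" "\<And>x. \<bar>f x\<bar> \<le> M"
  shows "integrable lborel f"
proof (rule Bochner_Integration.integrable_bound[of _ "\<lambda>x. M * indicator K x"])
  show "integrable lborel (\<lambda>x. M * indicator K x)"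
    using emeasure_compact_finite[OF assms(2)] assms(2)
    by (intro integrable_mult_right integrable_real_indicator) (auto intro: borel_compact)
  show "AE x in lborel. norm (f x) \<le> norm (M * indicator K x)"
  proof (intro AE_I2)
    fix x show "norm (f x) \<le> norm (M * indicator K x)"
      using assms(3,4)[of x] by (cases "x \<in> K") auto
  qed
qed (use assms in auto)

lemma integrable_continuous_compact_support:
  fixes f :: "heis \<Rightarrow> real"
  assumes "continuous_on UNIV f" "compact K" "\<And>x. x \<notin> K \<Longrightarrow> f x = 0"
  shows "integrable lborel f" "integrable lebesgue f"
proof -
  obtain M where "\<And>x. \<bar>f x\<bar> \<le> M" using continuous_compact_support_bounded[OF assms] by metis
  then show "integrable lborel f"
    by (intro integrable_bounded_compact_support[of f K M] borel_measurable_continuous_onI assms)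
  then show "integrable lebesgue f"
    using integrable_completion[of f lborel] borel_measurable_continuous_onI[OF assms(1)] by simp
qed

text \<open>By translation invariance every difference quotient along the axis integrates to 0. The
  mean value theorem bounds the quotients by a bound of the derivative, and dominated convergence
  passes to the limit.\<close>

lemma integral_pd_eq_0:
  assumes f: "f differentiable_on UNIV" "continuous_on UNIV (pd i f)"
    and K: "compact K" "\<And>x. x \<notin> K \<Longrightarrow> f x = 0"
  shows "(LINT x|lebesgue. pd i f x) = 0"
proof -
  define e :: heis where "e = axis i 1"
  have contf: "continuous_on UNIV f" using f(1) by (rule differentiable_imp_continuous_on)
  have fint: "integrable lborel f" by (rule integrable_continuous_compact_support(1)[OF contf K])
  obtain M where M: "\<And>x. \<bar>pd i f x\<bar> \<le> M" "M > 0"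
    using continuous_compact_support_bounded[OF f(2) K(1) pd_eq_0_outside[OF compact_imp_closed[OF K(1)] K(2)]] by metis
  \<comment> \<open>\<open>K\<close> swept backwards along the axis by at most one unit. Since the
    step lengths \<open>h n\<close> lie in (0, 1], it contains the supports of all difference
    quotients.\<close>
  define K' where "K' = (\<lambda>(y, t). y - t *\<^sub>R e) ` (K \<times> {0..1})"
  have K': "compact K'" unfolding K'_def
    by (intro compact_continuous_image compact_Times K(1) compact_Icc)
      (auto simp: case_prod_unfold intro!: continuous_intros)
  have K'I: "x \<in> K'" if "x + t *\<^sub>R e \<in> K" "0 \<le> t" "t \<le> 1" for x t
    unfolding K'_def using that by (intro image_eqI[of _ _ "(x + t *\<^sub>R e, t)"]) auto
  define h where "h n = inverse (real (Suc n))" for n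
  have h: "0 < h n" "h n \<le> 1" for n by (auto simp: h_def inverse_le_1_iff)
  define F where "F n x = (f (x + h n *\<^sub>R e) - f x) / h n" for n x
  have Fbound: "\<bar>F n x\<bar> \<le> M" for n x
  proof -
    from MVT2[OF h(1)[of n] pd_DERIV[OF f(1), of x i]]
    obtain z where "f (x + h n *\<^sub>R e) - f x = h n * pd i f (x + z *\<^sub>R e)" by (auto simp: e_def)
    then have "F n x = pd i f (x + z *\<^sub>R e)" using h(1)[of n] by (simp add: F_def)
    then show ?thesis using M by simp
  qed
  have Fsupp: "F n x = 0" if "x \<notin> K'" for n x
  proof -
    have "x \<notin> K" "x + h n *\<^sub>R e \<notin> K" using K'I[of x "h n"] K'I[of x 0] that h[of n] by auto
    then show ?thesis using K(2) by (simp add: F_def)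
  qed
  have Fmeas: "F n \<in> borel_measurable borel" for n
    unfolding F_def[abs_def] using borel_measurable_continuous_onI[OF contf]
    by (intro borel_measurable_divide borel_measurable_diff borel_measurable_const
        measurable_compose[OF _ borel_measurable_continuous_onI[OF contf]]) auto
  have Fint: "(LINT x|lborel. F n x) = 0" for n
  proof -
    have "integrable (distr lborel borel ((+) (h n *\<^sub>R e))) f" using fint by (simp add: lborel_distr_plus)
    then have i: "integrable lborel (\<lambda>x. f (x + h n *\<^sub>R e))"
      by (subst (asm) integrable_distr_eq) (use contf in \<open>auto simp: add.commute borel_measurable_continuous_onI\<close>)
    have "(LINT x|lborel. f x) = (LINT x|distr lborel borel ((+) (h n *\<^sub>R e)). f x)" by (simp add: lborel_distr_plus)
    also have "\<dots> = (LINT x|lborel. f (x + h n *\<^sub>R e))"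
      by (subst integral_distr) (use contf in \<open>auto simp: add.commute borel_measurable_continuous_onI\<close>)
    finally show ?thesis using i fint by (simp add: F_def)
  qed
  have "(\<lambda>n. LINT x|lborel. F n x) \<longlonglongrightarrow> (LINT x|lborel. pd i f x)"
  proof (rule integral_dominated_convergence[where w="\<lambda>x. M * indicator K' x"])
    show "pd i f \<in> borel_measurable lborel" using f(2) by (simp add: borel_measurable_continuous_onI)
    show "F n \<in> borel_measurable lborel" for n using Fmeas by simp
    show "integrable lborel (\<lambda>x. M * indicator K' x)"
      using emeasure_compact_finite[OF K'] K'
      by (intro integrable_mult_right integrable_real_indicator) (auto intro: borel_compact)
    show "AE x in lborel. norm (F n x) \<le> M * indicator K' x" for n
      using Fbound Fsupp by (intro AE_I2) (auto simp: indicator_def)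
    show "AE x in lborel. (\<lambda>n. F n x) \<longlonglongrightarrow> pd i f x"
    proof (intro AE_I2)
      fix x
      have "((\<lambda>t. (f (x + t *\<^sub>R e) - f x) / t) \<longlongrightarrow> pd i f x) (at 0)"
        using pd_DERIV[OF f(1), of x i 0] by (simp add: DERIV_def e_def)
      moreover have "filterlim h (at 0) sequentially"
        unfolding h_def[abs_def] filterlim_at using LIMSEQ_inverse_real_of_nat by auto
      ultimately show "(\<lambda>n. F n x) \<longlonglongrightarrow> pd i f x"
        unfolding F_def by (rule filterlim_compose)
    qed
  qed
  then have "(LINT x|lborel. pd i f x) = 0" using Fint LIMSEQ_unique[OF _ tendsto_const] by simp
  then show ?thesis
    by (subst integral_completion) (use f(2) in \<open>auto simp: borel_measurable_continuous_onI\<close>)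
qed

lemma test_functionE:
  assumes "\<phi> \<in> test_functions \<Omega>"
  obtains K where "compact K" "K \<subseteq> \<Omega>" "continuous_on UNIV \<phi>" "\<And>x. x \<notin> K \<Longrightarrow> \<phi> x = 0"
    "\<phi> differentiable_on UNIV" "\<And>i. continuous_on UNIV (pd i \<phi>)" "\<And>i x. x \<notin> K \<Longrightarrow> pd i \<phi> x = 0"
    "\<And>i. continuous_on UNIV (hX i \<phi>)" "\<And>i x. x \<notin> K \<Longrightarrow> hX i \<phi> x = 0"
proof
  let ?K = "closure {x. \<phi> x \<noteq> 0}"
  have C: "C_k n \<phi>" for n using assms by (simp add: test_functions_def)
  show pdc: "continuous_on UNIV (pd i \<phi>)" for i using C[of 1] by simp
  show z: "\<phi> x = 0" if "x \<notin> ?K" for x using that closure_subset[of "{x. \<phi> x \<noteq> 0}"] by auto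
  show pz: "pd i \<phi> x = 0" if "x \<notin> ?K" for i x by (rule pd_eq_0_outside[OF closed_closure _ that]) (rule z)
  show "hX i \<phi> x = 0" if "x \<notin> ?K" for i x using pz[OF that] by (simp add: hX_def)
  show "continuous_on UNIV (hX i \<phi>)" for i
    unfolding hX_def[abs_def] by (cases "i = 1") (auto intro!: continuous_intros pdc)
  show "continuous_on UNIV \<phi>" "\<phi> differentiable_on UNIV" using C[of 0] C[of 1] by simp_all
  show "compact ?K" "?K \<subseteq> \<Omega>" using assms by (simp_all add: test_functions_def)
qed

text \<open>The coefficients \<open>x $ 2\<close> and \<open>x $ 1\<close> do not depend on the
  third coordinate, so they can be moved under \<open>pd 3\<close>; every term is then the integral
  of a partial derivative of a compactly supported function. This is why constants have weak
  derivative 0.\<close>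

lemma integral_hX_eq_0:
  assumes "\<phi> \<in> test_functions \<Omega>"
  shows "(LINT x|lebesgue. hX i \<phi> x) = 0"
proof -
  obtain K where K: "compact K" "continuous_on UNIV \<phi>" "\<And>x. x \<notin> K \<Longrightarrow> \<phi> x = 0"
    "\<phi> differentiable_on UNIV" "\<And>i. continuous_on UNIV (pd i \<phi>)" "\<And>i x. x \<notin> K \<Longrightarrow> pd i \<phi> x = 0"
    by (rule test_functionE[OF assms]) (rule that; simp)
  have pd3: "pd 3 (\<lambda>x. x $ j * \<phi> x) x = x $ j * pd 3 \<phi> x" if "j \<noteq> 3" for j x
  proof -
    have "((\<lambda>x. x $ j * \<phi> x) has_derivative
        (\<lambda>h. x $ j * frechet_derivative \<phi> (at x) h + h $ j * \<phi> x)) (at x)"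
      using K(4) by (intro has_derivative_mult bounded_linear_imp_has_derivative bounded_linear_vec_nth)
        (simp add: differentiable_on_def frechet_derivative_works)
    from pd_eqI[OF this, of 3] that show ?thesis by (simp add: axis_def pd_def)
  qed
  have z3: "(LINT x|lebesgue. x $ j * pd 3 \<phi> x) = 0" if "j \<noteq> 3" for j
  proof -
    have "(\<lambda>x. x $ j * \<phi> x) differentiable_on UNIV"
      using K(4) by (intro differentiable_on_mult)
        (auto simp: differentiable_on_def intro: bounded_linear_imp_differentiable bounded_linear_vec_nth)
    moreover have "continuous_on UNIV (pd 3 (\<lambda>x. x $ j * \<phi> x))"
      using pd3[OF that] K(5) by (auto intro!: continuous_intros)
    ultimately show ?thesis
      using integral_pd_eq_0[of "\<lambda>x. x $ j * \<phi> x" 3, OF _ _ K(1)] K(3) pd3[OF that] by simp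
  qed
  have int: "integrable lebesgue (pd i \<phi>)" "integrable lebesgue (\<lambda>x. x $ j * pd i \<phi> x)" for i j
    by (rule integrable_continuous_compact_support(2)[OF _ K(1)]; use K in \<open>auto intro!: continuous_intros\<close>)+
  have z: "(LINT x|lebesgue. pd i \<phi> x) = 0" for i by (rule integral_pd_eq_0[OF K(4,5,1,3)])
  have eq: "hX 1 \<phi> = (\<lambda>x. pd 1 \<phi> x + 2 * (x $ 2 * pd 3 \<phi> x))" "hX 2 \<phi> = (\<lambda>x. pd 2 \<phi> x - 2 * (x $ 1 * pd 3 \<phi> x))"
    by (auto simp: hX_def)
  show ?thesis using exhaust_2[of i] z z3[of 1] z3[of 2] int by (auto simp: eq)
qed

lemma integrable_locally_integrable_times:
  assumes "\<Omega> \<in> sets lebesgue" "locally_integrable \<Omega> f" "compact K" "K \<subseteq> \<Omega>"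
    "continuous_on UNIV \<psi>" "\<And>x. x \<notin> K \<Longrightarrow> \<psi> x = 0"
  shows "integrable (lebesgue_on \<Omega>) (\<lambda>x. f x * \<psi> x)"
proof -
  have int: "integrable lebesgue (\<lambda>x. indicator K x * f x)" by (rule locally_integrableD[OF assms(2-4)])
  obtain M where M: "\<And>x. \<bar>\<psi> x\<bar> \<le> M" using continuous_compact_support_bounded[OF assms(5,3,6)] by metis
  have "integrable lebesgue (\<lambda>x. (indicator K x * f x) * \<psi> x)"
  proof (rule Bochner_Integration.integrable_bound[of _ "\<lambda>x. M * (indicator K x * f x)"])
    show "AE x in lebesgue. norm (indicator K x * f x * \<psi> x) \<le> norm (M * (indicator K x * f x))"
      using M by (intro AE_I2) (auto simp: abs_mult indicator_def mult.commute[of M]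
          intro!: mult_left_mono order_trans[OF M abs_ge_self])
    show "(\<lambda>x. indicator K x * f x * \<psi> x) \<in> borel_measurable lebesgue"
      by (intro borel_measurable_times borel_measurable_integrable[OF int] borel_measurable_continuous_UNIV assms)
  qed (use int in auto)
  moreover have "(\<lambda>x. (indicator K x * f x) * \<psi> x) = (\<lambda>x. indicator \<Omega> x *\<^sub>R (f x * \<psi> x))"
    using assms(4,6) by (force simp: indicator_def)
  ultimately show ?thesis using assms(1) by (simp add: integrable_restrict_space)
qed

lemma locally_integrable_linear:
  assumes "locally_integrable \<Omega> f" "locally_integrable \<Omega> g"
  shows "locally_integrable \<Omega> (\<lambda>x. a * f x + b * g x)"
  using assms unfolding locally_integrable_def by (auto intro!: set_integral_add set_integrable_mult_right)

lemma is_weak_X_linear: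
  assumes "open \<Omega>" "is_weak_X i \<Omega> f f'" "is_weak_X i \<Omega> g g'"
  shows "is_weak_X i \<Omega> (\<lambda>x. a * f x + b * g x) (\<lambda>x. a * f' x + b * g' x)"
  unfolding is_weak_X_def
proof (intro conjI ballI)
  have loc: "locally_integrable \<Omega> f" "locally_integrable \<Omega> f'" "locally_integrable \<Omega> g" "locally_integrable \<Omega> g'"
    using assms(2,3) by (auto simp: is_weak_X_def)
  then show "locally_integrable \<Omega> (\<lambda>x. a * f x + b * g x)" "locally_integrable \<Omega> (\<lambda>x. a * f' x + b * g' x)"
    by (auto intro: locally_integrable_linear)
  fix \<phi> assume phi: "\<phi> \<in> test_functions \<Omega>"
  have Om: "\<Omega> \<in> sets lebesgue" using assms(1) by simp
  obtain K where K: "compact K" "K \<subseteq> \<Omega>" "continuous_on UNIV \<phi>" "\<And>x. x \<notin> K \<Longrightarrow> \<phi> x = 0"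
    "continuous_on UNIV (hX i \<phi>)" "\<And>x. x \<notin> K \<Longrightarrow> hX i \<phi> x = 0"
    by (rule test_functionE[OF phi]) (rule that; simp)
  note int = integrable_locally_integrable_times[OF Om _ K(1,2)]
  note [simp] = int[OF loc(1) K(5,6)] int[OF loc(3) K(5,6)] int[OF loc(2) K(3,4)] int[OF loc(4) K(3,4)]
  have "(LINT x|lebesgue_on \<Omega>. (a * f x + b * g x) * hX i \<phi> x)
      = a * (LINT x|lebesgue_on \<Omega>. f x * hX i \<phi> x) + b * (LINT x|lebesgue_on \<Omega>. g x * hX i \<phi> x)"
    by (simp add: distrib_right mult.assoc)
  also have "\<dots> = - (a * (LINT x|lebesgue_on \<Omega>. f' x * \<phi> x) + b * (LINT x|lebesgue_on \<Omega>. g' x * \<phi> x))"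
    using assms(2,3) phi by (simp add: is_weak_X_def)
  also have "\<dots> = - (LINT x|lebesgue_on \<Omega>. (a * f' x + b * g' x) * \<phi> x)"
    by (simp add: distrib_right mult.assoc)
  finally show "(LINT x|lebesgue_on \<Omega>. (a * f x + b * g x) * hX i \<phi> x)
    = - (LINT x|lebesgue_on \<Omega>. (a * f' x + b * g' x) * \<phi> x)" .
qed

lemma locally_integrable_const: "locally_integrable \<Omega> (\<lambda>x. c)"
  unfolding locally_integrable_def
  by (auto intro!: absolutely_integrable_on_const lmeasurable_compact)

lemma is_weak_X_const: "is_weak_X i UNIV (\<lambda>x. c) (\<lambda>x. 0)"
  unfolding is_weak_X_def
  by (intro conjI ballI) (simp_all add: locally_integrable_const lebesgue_on_UNIV_eq integral_hX_eq_0[of _ UNIV])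

text \<open>The difference of two weak derivatives is a weak derivative of \<open>f - f\<close>,
  hence integrates to zero against every bump in \<open>\<Omega>\<close>.\<close>

lemma is_weak_X_unique:
  assumes "open \<Omega>" "is_weak_X i \<Omega> f g" "is_weak_X i \<Omega> f g'"
  shows "AE x in lebesgue_on \<Omega>. g x = g' x"
proof -
  have w: "is_weak_X i \<Omega> (\<lambda>x. 1 * f x + (-1) * f x) (\<lambda>x. 1 * g x + (-1) * g' x)"
    by (rule is_weak_X_linear[OF assms])
  have "AE x in lebesgue_on \<Omega>. 1 * g x + (-1) * g' x = 0"
  proof (rule AE_zero_of_bump_box_integrals[OF assms(1)])
    fix n p q assume "cbox p q \<subseteq> \<Omega>"
    from bump_box_test_function[OF this] w
    show "(LINT x|lebesgue_on \<Omega>. (1 * g x + (-1) * g' x) * bump_box n p q x) = 0"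
      by (simp add: is_weak_X_def)
  qed (use w in \<open>simp add: is_weak_X_def\<close>)
  then show ?thesis by simp
qed

lemma is_weak_X_wX: "is_weak_X i \<Omega> f g \<Longrightarrow> is_weak_X i \<Omega> f (wX i \<Omega> f)"
  unfolding wX_def by (rule someI[where P="is_weak_X i \<Omega> f"])

lemma wX_eq_AE: "open \<Omega> \<Longrightarrow> is_weak_X i \<Omega> f g \<Longrightarrow> AE x in lebesgue_on \<Omega>. wX i \<Omega> f x = g x"
  using is_weak_X_unique is_weak_X_wX by blast

subsection \<open>Periodic Sobolev functions and the quotient norm\<close>

text \<open>Completeness of Lebesgue measure: the two preimages of a Borel set differ only inside a
  null set. It transfers measurability from some weak derivative to the chosen one,
  \<open>wX\<close>.\<close>

lemma borel_measurable_lebesgue_on_cong_AE: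
  fixes f g :: "'a::euclidean_space \<Rightarrow> real"
  assumes S: "S \<in> sets lebesgue" and f: "f \<in> borel_measurable (lebesgue_on S)"
    and eq: "AE x in lebesgue_on S. f x = g x"
  shows "g \<in> borel_measurable (lebesgue_on S)"
proof -
  let ?f = "\<lambda>x. if x \<in> S then f x else 0" and ?g = "\<lambda>x. if x \<in> S then g x else 0"
  have f': "?f \<in> borel_measurable lebesgue" using f S by (simp add: borel_measurable_if)
  have "AE x in lebesgue. x \<in> S \<longrightarrow> f x = g x"
    using eq S by (simp add: AE_restrict_space_iff)
  then have eq': "AE x in lebesgue. ?f x = ?g x" by eventually_elim simp
  have "?g \<in> borel_measurable lebesgue"
  proof (rule measurableI)
    fix T :: "real set" assume T: "T \<in> sets borel"
    have "AE x in lebesgue. x \<in> ?f -` T \<inter> space lebesgue \<longleftrightarrow> x \<in> ?g -` T \<inter> space lebesgue"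
      using eq' by eventually_elim simp
    then show "?g -` T \<inter> space lebesgue \<in> sets lebesgue"
      by (rule completion.in_sets_AE[OF _ measurable_sets[OF f' T]]) simp
  qed simp
  then show ?thesis using S by (simp add: borel_measurable_if)
qed

lemma L2I: "f \<in> borel_measurable (lebesgue_on S) \<Longrightarrow> integrable (lebesgue_on S) (\<lambda>x. (f x)\<^sup>2) \<Longrightarrow> f \<in> L2 S"
  and L2_measurable: "f \<in> L2 S \<Longrightarrow> f \<in> borel_measurable (lebesgue_on S)"
  and L2_integrable: "f \<in> L2 S \<Longrightarrow> integrable (lebesgue_on S) (\<lambda>x. (f x)\<^sup>2)"
  by (auto simp: L2_def)

lemma L2_cong_AE:
  assumes "S \<in> sets lebesgue" "f \<in> L2 S" "AE x in lebesgue_on S. f x = g x"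
  shows "g \<in> L2 S"
proof (rule L2I)
  show g: "g \<in> borel_measurable (lebesgue_on S)"
    by (rule borel_measurable_lebesgue_on_cong_AE[OF assms(1) L2_measurable[OF assms(2)] assms(3)])
  show "integrable (lebesgue_on S) (\<lambda>x. (g x)\<^sup>2)"
  proof (rule integrable_cong_AE_imp[OF L2_integrable[OF assms(2)]])
    show "(\<lambda>x. (g x)\<^sup>2) \<in> borel_measurable (lebesgue_on S)" using g by simp
    show "AE x in lebesgue_on S. (f x)\<^sup>2 = (g x)\<^sup>2" using assms(3) by eventually_elim simp
  qed
qed

lemma L2_mult_integrable:
  assumes "f \<in> L2 S" "g \<in> L2 S"
  shows "integrable (lebesgue_on S) (\<lambda>x. f x * g x)"
proof (rule Bochner_Integration.integrable_bound)
  show "integrable (lebesgue_on S) (\<lambda>x. (f x)\<^sup>2 + (g x)\<^sup>2)" using assms by (simp add: L2_def)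
  show "(\<lambda>x. f x * g x) \<in> borel_measurable (lebesgue_on S)"
    using assms by (simp add: L2_def borel_measurable_times)
  have "\<bar>a * b\<bar> \<le> a\<^sup>2 + b\<^sup>2" for a b :: real
    using sum_squares_bound[of "\<bar>a\<bar>" "\<bar>b\<bar>"] mult_nonneg_nonneg[OF abs_ge_zero abs_ge_zero, of a b]
    by (simp only: abs_mult power2_abs mult.assoc)
  then show "AE x in lebesgue_on S. norm (f x * g x) \<le> norm ((f x)\<^sup>2 + (g x)\<^sup>2)"
    by (intro AE_I2) (simp add: abs_of_nonneg)
qed

lemma L2_linear:
  assumes "f \<in> L2 S" "g \<in> L2 S"
  shows "(\<lambda>x. a * f x + b * g x) \<in> L2 S"
proof (rule L2I)
  show "(\<lambda>x. a * f x + b * g x) \<in> borel_measurable (lebesgue_on S)"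
    using assms by (simp add: L2_def borel_measurable_times borel_measurable_add)
  have "integrable (lebesgue_on S) (\<lambda>x. a\<^sup>2 * (f x)\<^sup>2 + 2 * a * b * (f x * g x) + b\<^sup>2 * (g x)\<^sup>2)"
    using assms L2_mult_integrable[OF assms] by (simp add: L2_def)
  then show "integrable (lebesgue_on S) (\<lambda>x. (a * f x + b * g x)\<^sup>2)"
    by (simp add: power2_sum power_mult_distrib algebra_simps)
qed

lemma L2_zero: "(\<lambda>x. 0) \<in> L2 S" by (simp add: L2_def)

section \<open>The periodicity cell and the space \<open>H1per\<close>\<close>

lemma box_subset_Ycell: "box 0 (vec 2) \<subseteq> Ycell" and Ycell_subset_cbox: "Ycell \<subseteq> cbox 0 (vec 2)"
  by (auto simp: Ycell_def mem_box_cart less_imp_le)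

lemma Ycell_borel: "Ycell \<in> sets borel"
proof -
  have "Ycell = (\<Inter>i. {y. 0 \<le> y $ i} \<inter> {y. y $ i < 2})" by (auto simp: Ycell_def)
  also have "\<dots> \<in> sets borel"
    by (intro sets.finite_INT sets.Int borel_closed borel_open closed_Collect_le open_Collect_less continuous_intros) auto
  finally show ?thesis .
qed

lemma Ycell_lebesgue: "Ycell \<in> sets lebesgue" using Ycell_borel by simp

lemma Ycell_lmeasurable: "Ycell \<in> lmeasurable"
  using bounded_set_imp_lmeasurable[OF bounded_subset[OF bounded_cbox Ycell_subset_cbox] Ycell_lebesgue] .

interpretation Ycell: finite_measure "lebesgue_on Ycell"
  by (rule finite_measure_lebesgue_on[OF Ycell_lmeasurable])

lemma L2_Ycell_const: "(\<lambda>y. c) \<in> L2 Ycell" by (simp add: L2_def)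

lemma AE_Ycell: "AE y in lebesgue_on UNIV. P y \<Longrightarrow> AE y in lebesgue_on Ycell. P y"
  unfolding lebesgue_on_UNIV_eq by (simp add: AE_restrict_space_iff Ycell_lebesgue eventually_mono)

text \<open>\<open>H1per\<close> asks for square integrability of the derivatives over dilated
  cells; the factor 1 gives it over the cell itself.\<close>

lemma dil_1_Ycell: "dil 1 ` Ycell = Ycell"
proof -
  have "dil 1 = id" by (auto simp: dil_def vec_eq_iff forall_3 vector_3)
  then show ?thesis by simp
qed

lemma H1perD:
  assumes "f \<in> H1per"
  shows "Yperiodic f" "f \<in> L2 Ycell" "is_weak_X i UNIV f (wX i UNIV f)" "wX i UNIV f \<in> L2 Ycell"
proof -
  show "Yperiodic f" "f \<in> L2 Ycell" using assms by (auto simp: H1per_def L2per_def)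
  obtain g where g: "is_weak_X i UNIV f g" "\<forall>l>0. g \<in> L2 (dil l ` Ycell)"
    using assms by (auto simp: H1per_def)
  show "is_weak_X i UNIV f (wX i UNIV f)" by (rule is_weak_X_wX[OF g(1)])
  have "g \<in> L2 (dil 1 ` Ycell)" using g(2) by simp
  then show "wX i UNIV f \<in> L2 Ycell"
    unfolding dil_1_Ycell
    by (rule L2_cong_AE[OF Ycell_lebesgue _ AE_symmetric[OF AE_Ycell[OF wX_eq_AE[OF open_UNIV g(1)]]]])
qed

lemma H1per_linear:
  assumes "f \<in> H1per" "g \<in> H1per"
  shows "(\<lambda>y. a * f y + b * g y) \<in> H1per"
  unfolding H1per_def L2per_def
proof (intro CollectI conjI allI)
  show "Yperiodic (\<lambda>y. a * f y + b * g y)" using H1perD(1)[OF assms(1)] H1perD(1)[OF assms(2)]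
    by (simp add: Yperiodic_def)
  show "(\<lambda>y. a * f y + b * g y) \<in> L2 Ycell" by (intro L2_linear H1perD assms)
  fix i
  obtain f' where f': "is_weak_X i UNIV f f'" "\<forall>l>0. f' \<in> L2 (dil l ` Ycell)"
    using assms(1) by (auto simp: H1per_def)
  obtain g' where g': "is_weak_X i UNIV g g'" "\<forall>l>0. g' \<in> L2 (dil l ` Ycell)"
    using assms(2) by (auto simp: H1per_def)
  show "\<exists>h. is_weak_X i UNIV (\<lambda>y. a * f y + b * g y) h \<and> (\<forall>l>0. h \<in> L2 (dil l ` Ycell))"
    by (intro exI[of _ "\<lambda>x. a * f' x + b * g' x"] conjI is_weak_X_linear[OF open_UNIV f'(1) g'(1)])
      (simp add: L2_linear f'(2) g'(2))
qed

lemma H1per_const: "(\<lambda>y. c) \<in> H1per"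
  unfolding H1per_def L2per_def
  by (intro CollectI conjI allI exI[of _ "\<lambda>x. 0"] impI L2_zero is_weak_X_const L2_Ycell_const)
    (simp add: Yperiodic_def)

lemma H1per_add: "f \<in> H1per \<Longrightarrow> g \<in> H1per \<Longrightarrow> (\<lambda>y. f y + g y) \<in> H1per"
  and H1per_diff: "f \<in> H1per \<Longrightarrow> g \<in> H1per \<Longrightarrow> (\<lambda>y. f y - g y) \<in> H1per"
  and H1per_scale: "f \<in> H1per \<Longrightarrow> (\<lambda>y. r * f y) \<in> H1per"
  using H1per_linear[of f g 1 1] H1per_linear[of f g 1 "-1"] H1per_linear[of f f r 0] by simp_all

lemma wX_linear_AE:
  assumes "f \<in> H1per" "g \<in> H1per"
  shows "AE y in lebesgue_on Ycell. wX i UNIV (\<lambda>y. a * f y + b * g y) y = a * wX i UNIV f y + b * wX i UNIV g y"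
  by (intro AE_Ycell wX_eq_AE is_weak_X_linear H1perD(3) assms open_UNIV)

lemma wX_const_AE: "AE y in lebesgue_on Ycell. wX i UNIV (\<lambda>y. c) y = 0"
  by (intro AE_Ycell wX_eq_AE is_weak_X_const open_UNIV)

lemma hgrad_linear_AE:
  assumes "f \<in> H1per" "g \<in> H1per"
  shows "AE y in lebesgue_on Ycell.
    hgrad UNIV (\<lambda>y. a * f y + b * g y) y = a *\<^sub>R hgrad UNIV f y + b *\<^sub>R hgrad UNIV g y"
  using wX_linear_AE[OF assms, of 1 a b] wX_linear_AE[OF assms, of 2 a b]
  by eventually_elim (simp add: vec_eq_iff forall_2 hgrad_def)

lemma hgrad_const_AE: "AE y in lebesgue_on Ycell. hgrad UNIV (\<lambda>y. c) y = 0"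
  using wX_const_AE[of 1 c] wX_const_AE[of 2 c]
  by eventually_elim (simp add: vec_eq_iff forall_2 hgrad_def)

lemma hgrad_add_const_AE:
  assumes "f \<in> H1per"
  shows "AE y in lebesgue_on Ycell. hgrad UNIV (\<lambda>y. f y + c) y = hgrad UNIV f y"
  using hgrad_linear_AE[OF assms H1per_const, of 1 1 c] hgrad_const_AE[of c]
  by eventually_elim simp

definition L2field :: "(heis \<Rightarrow> real ^ 2) \<Rightarrow> bool" where
  "L2field v \<longleftrightarrow> (\<forall>i. (\<lambda>y. v y $ i) \<in> L2 Ycell)"

lemma L2field_const: "L2field (\<lambda>y. c)"
  by (simp add: L2field_def L2_Ycell_const)

lemma L2field_hgrad: "f \<in> H1per \<Longrightarrow> L2field (hgrad UNIV f)"
  by (simp add: L2field_def hgrad_def H1perD)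

lemma L2field_linear: "L2field v \<Longrightarrow> L2field w \<Longrightarrow> L2field (\<lambda>y. a *\<^sub>R v y + b *\<^sub>R w y)"
  by (simp add: L2field_def L2_linear)

lemma L2field_integrable:
  assumes "L2field v" shows "integrable (lebesgue_on Ycell) (\<lambda>y. (norm (v y))\<^sup>2)"
proof -
  have "(\<lambda>y. (norm (v y))\<^sup>2) = (\<lambda>y. (v y $ 1)\<^sup>2 + (v y $ 2)\<^sup>2)"
    by (simp add: norm_vec_def L2_set_def sum_2)
  then show ?thesis using assms L2_integrable by (simp add: L2field_def)
qed

text \<open>The right side is smallest at e = sqrt b / sqrt a, where it equals (sqrt a + sqrt b)^2;
  if a or b is zero the infimum need not be attained and is approached with an error d. The linear
  form of the hypothesis can be checked pointwise and integrated term by term, so the triangle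
  inequalities for the Sobolev norm and for the energy avoid mixed integrals.\<close>

lemma sqrt_le_add_sqrtI:
  assumes "a \<ge> 0" "b \<ge> 0" and X: "\<And>e. e > 0 \<Longrightarrow> X \<le> (1 + e) * a + (1 + 1 / e) * b"
  shows "sqrt X \<le> sqrt a + sqrt (b::real)"
proof -
  consider "a = 0" | "b = 0" | "a > 0" "b > 0" using assms(1,2) by linarith
  then have "X \<le> (sqrt a + sqrt b)\<^sup>2"
  proof cases
    case 1
    have "X \<le> b + d" if "d > 0" for d
    proof (cases "b = 0")
      case True then show ?thesis using X[of 1] 1 that by simp
    next
      case False
      then have "(1 + 1 / (b / d)) * b = b + d" by (simp add: field_simps)
      then show ?thesis using X[of "b / d"] 1 that False assms(2) by simp
    qed
    then have "X \<le> b" by (rule field_le_epsilon)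
    then show ?thesis using 1 assms(2) by simp
  next
    case 2
    have "X \<le> a + d" if "d > 0" for d
    proof (cases "a = 0")
      case True then show ?thesis using X[of 1] 2 that by simp
    next
      case False
      then have "(1 + d / a) * a = a + d" by (simp add: field_simps)
      then show ?thesis using X[of "d / a"] 2 that False assms(1) by simp
    qed
    then have "X \<le> a" by (rule field_le_epsilon)
    then show ?thesis using 2 assms(1) by simp
  next
    case 3
    define s t where "s = sqrt a" and "t = sqrt b"
    have st: "s > 0" "t > 0" "a = s\<^sup>2" "b = t\<^sup>2" using 3 by (auto simp: s_def t_def)
    have "X \<le> (1 + t / s) * s\<^sup>2 + (1 + 1 / (t / s)) * t\<^sup>2"
      using X[of "t / s"] st by simp
    also have "\<dots> = (s + t)\<^sup>2" using st(1,2) by (simp add: field_simps power2_eq_square)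
    finally show ?thesis by (simp add: s_def t_def)
  qed
  then have "sqrt X \<le> sqrt ((sqrt a + sqrt b)\<^sup>2)" by (rule real_sqrt_le_mono)
  then show ?thesis using assms(1,2) by simp
qed

lemma square_add_le: "e > 0 \<Longrightarrow> (a + b)\<^sup>2 \<le> (1 + e) * a\<^sup>2 + (1 + 1 / e) * (b::real)\<^sup>2"
proof -
  assume e: "e > 0"
  have "(1 + e) * a\<^sup>2 + (1 + 1 / e) * b\<^sup>2 - (a + b)\<^sup>2 = (e * a - b)\<^sup>2 / e"
    using e by (simp add: field_simps power2_eq_square)
  moreover have "\<dots> \<ge> 0" using e by simp
  ultimately show ?thesis by linarith
qed

section \<open>The norm of \<open>H1per\<close> and of its quotient by the constants\<close>

definition H1per_sq :: "(heis \<Rightarrow> real) \<Rightarrow> real" where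
  "H1per_sq f = (LINT y|lebesgue_on Ycell. (f y)\<^sup>2) + (LINT y|lebesgue_on Ycell. (norm (hgrad UNIV f y))\<^sup>2)"

lemma H1per_norm_eq: "f \<in> H1per \<Longrightarrow> H1per_norm f = sqrt (H1per_sq f)"
proof -
  assume f: "f \<in> H1per"
  have "(\<lambda>y. (norm (hgrad UNIV f y))\<^sup>2) = (\<lambda>y. (wX 1 UNIV f y)\<^sup>2 + (wX 2 UNIV f y)\<^sup>2)"
    by (simp add: norm_vec_def L2_set_def sum_2 hgrad_def)
  then show ?thesis using L2_integrable[OF H1perD(4)[OF f]]
    by (simp add: H1per_norm_def H1per_sq_def sum_2)
qed

lemma H1per_sq_nonneg: "H1per_sq f \<ge> 0"
  by (simp add: H1per_sq_def)

lemma integral_norm_sq_cong_AE: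
  assumes "L2field v" "L2field w" "AE y in lebesgue_on Ycell. v y = w y"
  shows "(LINT y|lebesgue_on Ycell. (norm (v y))\<^sup>2) = (LINT y|lebesgue_on Ycell. (norm (w y))\<^sup>2)"
proof (rule integral_cong_AE)
  show "AE y in lebesgue_on Ycell. (norm (v y))\<^sup>2 = (norm (w y))\<^sup>2" using assms(3) by eventually_elim simp
qed (intro borel_measurable_integrable L2field_integrable assms)+

lemma H1per_sq_add:
  assumes f: "f \<in> H1per" and g: "g \<in> H1per" and "e > 0"
  shows "H1per_sq (\<lambda>y. f y + g y) \<le> (1 + e) * H1per_sq f + (1 + 1 / e) * H1per_sq g"
proof -
  let ?M = "lebesgue_on Ycell"
  note fg = H1per_add[OF f g]
  note [simp] = L2_integrable[OF H1perD(2)[OF f]] L2_integrable[OF H1perD(2)[OF g]] L2_integrable[OF H1perD(2)[OF fg]]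
    L2field_integrable[OF L2field_hgrad[OF f]] L2field_integrable[OF L2field_hgrad[OF g]] L2field_integrable[OF L2field_hgrad[OF fg]]
  have "(LINT y|?M. (f y + g y)\<^sup>2) \<le> (LINT y|?M. (1 + e) * (f y)\<^sup>2 + (1 + 1 / e) * (g y)\<^sup>2)"
    by (rule integral_mono) (use square_add_le[OF \<open>e > 0\<close>] in auto)
  also have "\<dots> = (1 + e) * (LINT y|?M. (f y)\<^sup>2) + (1 + 1 / e) * (LINT y|?M. (g y)\<^sup>2)" by simp
  finally have 1: "(LINT y|?M. (f y + g y)\<^sup>2) \<le> \<dots>" .
  have "(LINT y|?M. (norm (hgrad UNIV (\<lambda>y. f y + g y) y))\<^sup>2)
      \<le> (LINT y|?M. (1 + e) * (norm (hgrad UNIV f y))\<^sup>2 + (1 + 1 / e) * (norm (hgrad UNIV g y))\<^sup>2)"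
  proof (rule integral_mono_AE)
    show "AE y in ?M. (norm (hgrad UNIV (\<lambda>y. f y + g y) y))\<^sup>2
        \<le> (1 + e) * (norm (hgrad UNIV f y))\<^sup>2 + (1 + 1 / e) * (norm (hgrad UNIV g y))\<^sup>2"
      using hgrad_linear_AE[OF f g, of 1 1]
    proof eventually_elim
      case (elim y)
      then have "(norm (hgrad UNIV (\<lambda>y. f y + g y) y))\<^sup>2 \<le> (norm (hgrad UNIV f y) + norm (hgrad UNIV g y))\<^sup>2"
        by (intro power_mono) (auto simp: norm_triangle_ineq)
      then show ?case using square_add_le[OF \<open>e > 0\<close>, of "norm (hgrad UNIV f y)" "norm (hgrad UNIV g y)"]
        by linarith
    qed
  qed simp_all
  also have "\<dots> = (1 + e) * (LINT y|?M. (norm (hgrad UNIV f y))\<^sup>2) + (1 + 1 / e) * (LINT y|?M. (norm (hgrad UNIV g y))\<^sup>2)" by simp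
  finally show ?thesis using 1 unfolding H1per_sq_def distrib_left by linarith
qed

lemma H1per_norm_nonneg: "f \<in> H1per \<Longrightarrow> H1per_norm f \<ge> 0"
  by (simp add: H1per_norm_eq H1per_sq_nonneg)

lemma H1per_norm_triangle:
  assumes "f \<in> H1per" "g \<in> H1per"
  shows "H1per_norm (\<lambda>y. f y + g y) \<le> H1per_norm f + H1per_norm g"
  using sqrt_le_add_sqrtI[OF H1per_sq_nonneg H1per_sq_nonneg H1per_sq_add[OF assms]] assms
  by (simp add: H1per_norm_eq H1per_add)

lemma H1per_norm_scale:
  assumes "f \<in> H1per"
  shows "H1per_norm (\<lambda>y. r * f y) = \<bar>r\<bar> * H1per_norm f"
proof -
  have "(LINT y|lebesgue_on Ycell. (norm (hgrad UNIV (\<lambda>y. r * f y) y))\<^sup>2)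
      = (LINT y|lebesgue_on Ycell. (norm (r *\<^sub>R hgrad UNIV f y))\<^sup>2)"
    using L2field_linear[OF L2field_hgrad[OF assms] L2field_hgrad[OF assms], of r 0]
      hgrad_linear_AE[OF assms assms, of r 0]
    by (intro integral_norm_sq_cong_AE L2field_hgrad H1per_scale assms) simp_all
  then have "H1per_sq (\<lambda>y. r * f y) = r\<^sup>2 * H1per_sq f"
    by (simp add: H1per_sq_def power_mult_distrib distrib_left)
  then show ?thesis using assms by (simp add: H1per_norm_eq H1per_scale real_sqrt_mult)
qed

lemma quot_norm_le: "f \<in> H1per \<Longrightarrow> quot_norm f \<le> H1per_norm (\<lambda>y. f y + c)"
  unfolding quot_norm_def
  by (rule cINF_lower) (auto intro!: bdd_belowI[of _ 0] H1per_norm_nonneg H1per_add H1per_const)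

lemma quot_norm_greatest: "(\<And>c. b \<le> H1per_norm (\<lambda>y. f y + c)) \<Longrightarrow> b \<le> quot_norm f"
  unfolding quot_norm_def by (rule cINF_greatest) auto

lemma quot_norm_nonneg: "f \<in> H1per \<Longrightarrow> quot_norm f \<ge> 0"
  by (intro quot_norm_greatest H1per_norm_nonneg H1per_add H1per_const)

lemma quot_norm_triangle:
  assumes f: "f \<in> H1per" and g: "g \<in> H1per"
  shows "quot_norm (\<lambda>y. f y + g y) \<le> quot_norm f + quot_norm g"
proof -
  have "quot_norm (\<lambda>y. f y + g y) \<le> H1per_norm (\<lambda>y. f y + c) + H1per_norm (\<lambda>y. g y + d)" for c d
  proof -
    have "quot_norm (\<lambda>y. f y + g y) \<le> H1per_norm (\<lambda>y. (f y + g y) + (c + d))"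
      by (intro quot_norm_le H1per_add f g)
    also have "(\<lambda>y. (f y + g y) + (c + d)) = (\<lambda>y. (f y + c) + (g y + d))" by (simp add: algebra_simps)
    also have "H1per_norm \<dots> \<le> H1per_norm (\<lambda>y. f y + c) + H1per_norm (\<lambda>y. g y + d)"
      by (intro H1per_norm_triangle H1per_add H1per_const f g)
    finally show ?thesis .
  qed
  then have "quot_norm (\<lambda>y. f y + g y) - H1per_norm (\<lambda>y. g y + d) \<le> quot_norm f" for d
    by (intro quot_norm_greatest) (simp add: diff_le_eq)
  then have "quot_norm (\<lambda>y. f y + g y) - quot_norm f \<le> quot_norm g"
    by (intro quot_norm_greatest) (simp add: algebra_simps)
  then show ?thesis by simp
qed

lemma quot_norm_scale_le:
  assumes "f \<in> H1per"
  shows "quot_norm (\<lambda>y. r * f y) \<le> \<bar>r\<bar> * H1per_norm f"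
  using quot_norm_le[OF H1per_scale[OF assms], of r 0] H1per_norm_scale[OF assms] by simp

lemma quot_norm_minus:
  assumes "f \<in> H1per"
  shows "quot_norm (\<lambda>y. - f y) = quot_norm f"
proof -
  have le: "quot_norm (\<lambda>y. - f y) \<le> quot_norm f" if f: "f \<in> H1per" for f
  proof (rule quot_norm_greatest)
    fix c
    have "quot_norm (\<lambda>y. -1 * f y) \<le> H1per_norm (\<lambda>y. -1 * f y + -1 * c)"
      by (intro quot_norm_le H1per_scale f)
    also have "(\<lambda>y. -1 * f y + -1 * c) = (\<lambda>y. -1 * (f y + c))" by (simp add: algebra_simps)
    also have "H1per_norm \<dots> = H1per_norm (\<lambda>y. f y + c)"
      by (subst H1per_norm_scale) (auto intro!: H1per_add H1per_const f)
    finally show "quot_norm (\<lambda>y. - f y) \<le> H1per_norm (\<lambda>y. f y + c)" by simp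
  qed
  show ?thesis using le[OF assms] le[OF H1per_scale[OF assms, of "-1"]] by simp
qed

lemma quot_norm_diff_commute:
  assumes "f \<in> H1per" "g \<in> H1per"
  shows "quot_norm (\<lambda>y. f y - g y) = quot_norm (\<lambda>y. g y - f y)"
  using quot_norm_minus[OF H1per_diff[OF assms]] by simp

text \<open>The reverse triangle inequality for an abstract \<open>p\<close>, used both for
  \<open>quot_norm\<close> itself, with constant 1, and for the square root of the energy. It
  supplies the Lipschitz bounds on which measurability in \<open>x\<close> rests.\<close>

lemma abs_diff_le_of_triangle:
  assumes tri: "\<And>f g. f \<in> H1per \<Longrightarrow> g \<in> H1per \<Longrightarrow> p (\<lambda>y. f y + g y) \<le> p f + p g"
    and le: "\<And>f. f \<in> H1per \<Longrightarrow> p f \<le> C * quot_norm f"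
    and f: "f \<in> H1per" and g: "g \<in> H1per"
  shows "\<bar>p f - p g\<bar> \<le> C * quot_norm (\<lambda>y. f y - g y)"
proof -
  have "p f - p g \<le> C * quot_norm (\<lambda>y. f y - g y)" if f: "f \<in> H1per" and g: "g \<in> H1per" for f g
    using tri[OF H1per_diff[OF f g] g] le[OF H1per_diff[OF f g]] by simp
  from this[OF f g] this[OF g f] quot_norm_diff_commute[OF f g] show ?thesis by (simp add: abs_le_iff)
qed

lemma quot_norm_abs_diff:
  assumes "f \<in> H1per" "g \<in> H1per"
  shows "\<bar>quot_norm f - quot_norm g\<bar> \<le> 1 * quot_norm (\<lambda>y. f y - g y)"
  by (rule abs_diff_le_of_triangle[OF quot_norm_triangle]) (use assms in auto)

text \<open>Adding a constant changes the gradient only on a null set, so the gradient part bounds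
  every competitor in the infimum from below.\<close>

lemma gradient_energy_le_quot_norm:
  assumes "f \<in> H1per"
  shows "sqrt (LINT y|lebesgue_on Ycell. (norm (hgrad UNIV f y))\<^sup>2) \<le> quot_norm f"
proof (rule quot_norm_greatest)
  fix c
  have fc: "(\<lambda>y. f y + c) \<in> H1per" by (intro H1per_add H1per_const assms)
  have "(LINT y|lebesgue_on Ycell. (norm (hgrad UNIV f y))\<^sup>2) = (LINT y|lebesgue_on Ycell. (norm (hgrad UNIV (\<lambda>y. f y + c) y))\<^sup>2)"
    by (intro integral_norm_sq_cong_AE L2field_hgrad assms fc AE_symmetric[OF hgrad_add_const_AE])
  then show "sqrt (LINT y|lebesgue_on Ycell. (norm (hgrad UNIV f y))\<^sup>2) \<le> H1per_norm (\<lambda>y. f y + c)"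
    using fc by (simp add: H1per_norm_eq H1per_sq_def)
qed

subsection \<open>Periodic functions with vanishing horizontal gradient\<close>

text \<open>The support is kept strictly inside (0, 2), an edge of the cell, so that products of
  three such functions are supported in the interior of the cell, where the gradient is known to
  vanish.\<close>

definition compact_smooth1 :: "(real \<Rightarrow> real) \<Rightarrow> bool" where
  "compact_smooth1 a \<longleftrightarrow> smooth1 a \<and> (\<exists>p q. 0 < p \<and> q < 2 \<and> (\<forall>t. t \<notin> {p..q} \<longrightarrow> a t = 0))"

lemma compact_smooth1_smooth: "compact_smooth1 a \<Longrightarrow> smooth1 a"
  by (simp add: compact_smooth1_def)

lemma compact_smooth1_E:
  assumes "compact_smooth1 a"
  obtains p q where "0 < p" "q < 2" "\<And>t. t \<notin> {p..q} \<Longrightarrow> a t = 0"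
  using assms by (auto simp: compact_smooth1_def)

lemma compact_smooth1_bump: "0 < p \<Longrightarrow> q < 2 \<Longrightarrow> compact_smooth1 (bump n p q)"
  unfolding compact_smooth1_def
  by (intro conjI smooth1_bump exI[of _ p] exI[of _ q]) (auto intro!: bump_eq_0)

lemma compact_smooth1_ident_mult: "compact_smooth1 a \<Longrightarrow> compact_smooth1 (\<lambda>t. t * a t)"
  by (auto simp: compact_smooth1_def smooth1_mult smooth1_ident)

lemma compact_smooth1_deriv:
  assumes "compact_smooth1 a" shows "compact_smooth1 (deriv a)"
proof -
  obtain p q where pq: "0 < p" "q < 2" "\<And>t. t \<notin> {p..q} \<Longrightarrow> a t = 0"
    by (rule compact_smooth1_E[OF assms]) (rule that; simp)
  have "deriv a t = 0" if "t \<notin> {p..q}" for t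
  proof (rule DERIV_imp_deriv)
    have "((\<lambda>x. 0) has_real_derivative 0) (at t)" by simp
    then show "(a has_real_derivative 0) (at t)"
      by (rule has_field_derivative_transform_within_open[of _ _ _ "- {p..q}"]) (use that pq(3) in auto)
  qed
  then show ?thesis unfolding compact_smooth1_def
    using pq smooth1_deriv[OF compact_smooth1_smooth[OF assms]] by blast
qed

text \<open>With the primitive normalised to vanish near 0, \<open>F 2\<close> is the total integral
  of \<open>c\<close>, and it is the only obstruction to compact support of
  \<open>F\<close>.\<close>

lemma compact_smooth1_primitive:
  assumes "compact_smooth1 c"
  obtains F p q where "\<And>t. (F has_real_derivative c t) (at t)" "0 < p" "q < 2"
    "\<And>t. t < p \<Longrightarrow> F t = 0" "\<And>t. t > q \<Longrightarrow> F t = F 2"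
proof -
  obtain p q where pq: "0 < p" "q < 2" "\<And>t. t \<notin> {p..q} \<Longrightarrow> c t = 0"
    by (rule compact_smooth1_E[OF assms]) (rule that; simp)
  have "isCont c x" for x
    using smooth1_continuous[OF compact_smooth1_smooth[OF assms], of UNIV] by (simp add: continuous_on_eq_continuous_at)
  then have "\<exists>F. \<forall>x::real. -\<infinity> < ereal x \<longrightarrow> ereal x < \<infinity> \<longrightarrow> (F has_vector_derivative c x) (at x)"
    by (intro einterval_antiderivative) auto
  then obtain F where "\<And>x. (F has_real_derivative c x) (at x)"
    by (auto simp: has_real_derivative_iff_has_vector_derivative)
  then have F: "((\<lambda>t. F t - F 0) has_real_derivative c x) (at x)" for x
    by (auto intro!: derivative_eq_intros)
  have const: "F s = F t" if st: "s < t" "\<And>x. s < x \<Longrightarrow> x < t \<Longrightarrow> c x = 0" for s t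
  proof -
    obtain z where "s < z" "z < t" "F t - F 0 - (F s - F 0) = (t - s) * c z"
      using MVT2[OF st(1) F] by auto
    then show ?thesis using st by auto
  qed
  have c0: "t < p \<or> q < t \<Longrightarrow> c t = 0" for t using pq(3)[of t] by auto
  have left: "F s = F t" if "s < t" "t < p" for s t
    by (rule const[OF that(1)], rule c0) (use that in auto)
  have right: "F s = F t" if "s < t" "q < s" for s t
    by (rule const[OF that(1)], rule c0) (use that in auto)
  have "F t - F 0 = 0" if t: "t < p" for t
    using left[of t 0] left[of 0 t] pq(1) t by (metis diff_self linorder_neqE_linordered_idom)
  moreover have "F t - F 0 = F 2 - F 0" if t: "t > q" for t
    using right[of t 2] right[of 2 t] pq(2) t by (metis linorder_neqE_linordered_idom)
  ultimately show thesis using F pq(1,2) by (intro that[of "\<lambda>t. F t - F 0" p q])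
qed

text \<open>The reference bump of the du Bois-Reymond argument; what matters is its nonzero integral
  and its support inside (0, 2).\<close>

definition eta :: "real \<Rightarrow> real" where "eta = bump 1 (1/2) (3/2)"

lemma compact_smooth1_eta: "compact_smooth1 eta"
  unfolding eta_def by (rule compact_smooth1_bump) auto

text \<open>A function of this class with integral zero is the derivative of another one;
  subtracting a multiple of \<open>eta\<close> removes the integral.\<close>

lemma compact_smooth1_decompose:
  assumes "compact_smooth1 c"
  obtains C r where "compact_smooth1 C" "c = (\<lambda>t. deriv C t + r * eta t)"
proof -
  obtain F p q where F: "\<And>t. (F has_real_derivative c t) (at t)" "0 < p" "q < 2"
    "\<And>t. t < p \<Longrightarrow> F t = 0" "\<And>t. t > q \<Longrightarrow> F t = F 2"
    using compact_smooth1_primitive[OF assms] by metis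
  obtain G p' q' where G: "\<And>t. (G has_real_derivative eta t) (at t)" "0 < p'" "q' < 2"
    "\<And>t. t < p' \<Longrightarrow> G t = 0" "\<And>t. t > q' \<Longrightarrow> G t = G 2"
    using compact_smooth1_primitive[OF compact_smooth1_eta] by metis
  have "G 2 > 0"
  proof -
    have nn: "\<exists>y. (G has_real_derivative y) (at t) \<and> 0 \<le> y" for t
      using G(1)[of t] bump_nonneg[of 1 "1/2" "3/2" t] by (auto simp: eta_def)
    have pos: "\<exists>y. (G has_real_derivative y) (at t) \<and> 0 < y" if "1/2 < t" "t < 3/2" for t
      using G(1)[of t] bump_pos[of 1 "1/2" t "3/2"] that by (auto simp: eta_def)
    have "G 0 \<le> G (1/2)"
      by (rule DERIV_nonneg_imp_nondecreasing[of 0 "1/2" G]) (use nn in auto)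
    also have "\<dots> < G (3/2)"
      by (rule DERIV_pos_imp_increasing_open[of "1/2" "3/2" G])
        (use pos in \<open>auto intro!: continuous_at_imp_continuous_on DERIV_isCont[OF G(1)]\<close>)
    also have "\<dots> \<le> G 2"
      by (rule DERIV_nonneg_imp_nondecreasing[of "3/2" 2 G]) (use nn in auto)
    finally show ?thesis using G(2) G(4)[of 0] by simp
  qed
  \<comment> \<open>The quotient of the two total integrals, so that the primitive \<open>C\<close>
    of \<open>c - r * eta\<close> vanishes to the right of both supports as well.\<close>
  define r where "r = F 2 / G 2"
  define C where "C t = F t - r * G t" for t
  have D: "(C has_real_derivative c t - r * eta t) (at t)" for t
    unfolding C_def by (auto intro!: derivative_eq_intros F(1) G(1))
  have "smooth1 (\<lambda>t. c t + (- r) * eta t)"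
    by (intro smooth1_add smooth1_mult smooth1_const compact_smooth1_smooth assms compact_smooth1_eta)
  then have "smooth1 C" by (intro smooth1_antiderivative[of C, OF D]) simp
  moreover have "C t = 0" if t: "t \<notin> {min p p'..max q q'}" for t
  proof -
    consider "t < p" "t < p'" | "t > q" "t > q'" using t by fastforce
    then show ?thesis
    proof cases
      case 1 then show ?thesis using F(4) G(4) by (simp add: C_def)
    next
      case 2 then show ?thesis using F(5)[of t] G(5)[of t] \<open>G 2 > 0\<close> by (simp add: C_def r_def)
    qed
  qed
  ultimately have "compact_smooth1 C" unfolding compact_smooth1_def
    using F(2,3) G(2,3) by (intro conjI exI[of _ "min p p'"] exI[of _ "max q q'"]) auto
  moreover have "c = (\<lambda>t. deriv C t + r * eta t)" using DERIV_imp_deriv[OF D] by auto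
  ultimately show thesis by (rule that)
qed

lemma compact_smooth1_tensor:
  assumes "compact_smooth1 a" "compact_smooth1 b" "compact_smooth1 c"
  obtains K where "compact K" "K \<subseteq> box 0 (vec 2)" "\<And>x. x \<notin> K \<Longrightarrow> tensor a b c x = 0"
proof -
  obtain p1 q1 where 1: "0 < p1" "q1 < 2" "\<And>t. t \<notin> {p1..q1} \<Longrightarrow> a t = 0"
    by (rule compact_smooth1_E[OF assms(1)]) (rule that; simp)
  obtain p2 q2 where 2: "0 < p2" "q2 < 2" "\<And>t. t \<notin> {p2..q2} \<Longrightarrow> b t = 0"
    by (rule compact_smooth1_E[OF assms(2)]) (rule that; simp)
  obtain p3 q3 where 3: "0 < p3" "q3 < 2" "\<And>t. t \<notin> {p3..q3} \<Longrightarrow> c t = 0"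
    by (rule compact_smooth1_E[OF assms(3)]) (rule that; simp)
  define p q :: heis where "p = vector [p1, p2, p3]" and "q = vector [q1, q2, q3]"
  have pq: "p$1 = p1" "p$2 = p2" "p$3 = p3" "q$1 = q1" "q$2 = q2" "q$3 = q3"
    by (simp_all add: p_def q_def vector_3)
  show thesis
  proof (rule that)
    show "compact (cbox p q)" by (rule compact_cbox)
    show "cbox p q \<subseteq> box 0 (vec 2)" using 1 2 3 by (auto simp: mem_box_cart forall_3 pq)
    show "tensor a b c x = 0" if "x \<notin> cbox p q" for x
      by (rule tensor_support[OF _ _ _ that]; unfold pq; rule 1 2 3)
  qed
qed

lemma continuous_tensor: "smooth1 a \<Longrightarrow> smooth1 b \<Longrightarrow> smooth1 c \<Longrightarrow> continuous_on UNIV (tensor a b c)"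
  using C_k_tensor[of a b c 0] by simp

section \<open>The weak equations on the cell as a trilinear pairing\<close>

context
  fixes h :: "heis \<Rightarrow> real"
  assumes h: "h \<in> H1per" and hgrad_h: "AE y in lebesgue_on Ycell. hgrad UNIV h y = 0"
begin

definition pairing :: "(real \<Rightarrow> real) \<Rightarrow> (real \<Rightarrow> real) \<Rightarrow> (real \<Rightarrow> real) \<Rightarrow> real" where
  "pairing a b c = (LINT x|lebesgue. h x * tensor a b c x)"

lemma integrable_pairing:
  assumes "compact_smooth1 a" "compact_smooth1 b" "compact_smooth1 c"
  shows "integrable lebesgue (\<lambda>x. h x * tensor a b c x)"
proof -
  obtain K where K: "compact K" "K \<subseteq> box 0 (vec 2)" "\<And>x. x \<notin> K \<Longrightarrow> tensor a b c x = 0"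
    by (rule compact_smooth1_tensor[OF assms]) (erule that; simp)
  have "locally_integrable UNIV h" using H1perD(3)[OF h] by (simp add: is_weak_X_def)
  then have "integrable (lebesgue_on UNIV) (\<lambda>x. h x * tensor a b c x)"
    using K(1,3) assms by (intro integrable_locally_integrable_times[where K=K] continuous_tensor compact_smooth1_smooth) auto
  then show ?thesis by (simp add: lebesgue_on_UNIV_eq)
qed

lemma pairing_linear:
  assumes "compact_smooth1 a" "compact_smooth1 a'" "compact_smooth1 b" "compact_smooth1 c"
  shows "pairing (\<lambda>t. r * a t + s * a' t) b c = r * pairing a b c + s * pairing a' b c"
    "pairing b (\<lambda>t. r * a t + s * a' t) c = r * pairing b a c + s * pairing b a' c"
    "pairing b c (\<lambda>t. r * a t + s * a' t) = r * pairing b c a + s * pairing b c a'"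
proof -
  have lin: "(LINT x|lebesgue. r * (h x * f x) + s * (h x * g x)) = r * (LINT x|lebesgue. h x * f x) + s * (LINT x|lebesgue. h x * g x)"
    if "integrable lebesgue (\<lambda>x. h x * f x)" "integrable lebesgue (\<lambda>x. h x * g x)" for f g
    using that by simp
  show "pairing (\<lambda>t. r * a t + s * a' t) b c = r * pairing a b c + s * pairing a' b c"
    unfolding pairing_def
    by (subst lin[symmetric]) (intro integrable_pairing assms | simp add: tensor_def algebra_simps)+
  show "pairing b (\<lambda>t. r * a t + s * a' t) c = r * pairing b a c + s * pairing b a' c"
    unfolding pairing_def
    by (subst lin[symmetric]) (intro integrable_pairing assms | simp add: tensor_def algebra_simps)+
  show "pairing b c (\<lambda>t. r * a t + s * a' t) = r * pairing b c a + s * pairing b c a'"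
    unfolding pairing_def
    by (subst lin[symmetric]) (intro integrable_pairing assms | simp add: tensor_def algebra_simps)+
qed

text \<open>The weak derivative is taken on the whole space, but the product is supported in the
  cell, where that derivative is zero almost everywhere.\<close>

lemma pairing_hX:
  assumes "compact_smooth1 a" "compact_smooth1 b" "compact_smooth1 c"
  shows "(LINT x|lebesgue. h x * hX i (tensor a b c) x) = 0"
proof -
  obtain K where K: "compact K" "K \<subseteq> box 0 (vec 2)" "\<And>x. x \<notin> K \<Longrightarrow> tensor a b c x = 0"
    by (rule compact_smooth1_tensor[OF assms]) (erule that; simp)
  have "tensor a b c \<in> test_functions UNIV"
    by (rule tensor_in_test_functions[OF _ _ _ K(3,1)]) (use assms compact_smooth1_smooth in auto)
  then have "(LINT x|lebesgue. h x * hX i (tensor a b c) x) = - (LINT x|lebesgue. wX i UNIV h x * tensor a b c x)"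
    using H1perD(3)[OF h, of i] by (simp add: is_weak_X_def lebesgue_on_UNIV_eq)
  also have "(LINT x|lebesgue. wX i UNIV h x * tensor a b c x) = 0"
  proof (rule integral_eq_zero_AE)
    have "AE x in lebesgue. x \<in> Ycell \<longrightarrow> hgrad UNIV h x = 0"
      using hgrad_h by (simp add: AE_restrict_space_iff Ycell_lebesgue)
    then show "AE x in lebesgue. wX i UNIV h x * tensor a b c x = 0"
    proof eventually_elim
      case (elim x)
      have "x \<notin> Ycell \<Longrightarrow> tensor a b c x = 0" using K(2,3) box_subset_Ycell by blast
      moreover have "x \<in> Ycell \<Longrightarrow> wX i UNIV h x = 0" using elim by (simp add: hgrad_def vec_eq_iff)
      ultimately show ?case by (cases "x \<in> Ycell") auto
    qed
  qed
  finally show ?thesis by simp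
qed

lemma pairing_X:
  assumes "compact_smooth1 a" "compact_smooth1 b" "compact_smooth1 c"
  shows "pairing (deriv a) b c + 2 * pairing a (\<lambda>t. t * b t) (deriv c) = 0"
    "pairing a (deriv b) c - 2 * pairing (\<lambda>t. t * a t) b (deriv c) = 0"
proof -
  note s = compact_smooth1_smooth[OF assms(1)] compact_smooth1_smooth[OF assms(2)] compact_smooth1_smooth[OF assms(3)]
  note [simp] = integrable_pairing assms compact_smooth1_deriv compact_smooth1_ident_mult
  have "pairing (deriv a) b c + 2 * pairing a (\<lambda>t. t * b t) (deriv c)
    = (LINT x|lebesgue. h x * tensor (deriv a) b c x + 2 * (h x * tensor a (\<lambda>t. t * b t) (deriv c) x))"
    by (simp add: pairing_def)
  also have "\<dots> = (LINT x|lebesgue. h x * hX 1 (tensor a b c) x)"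
    by (simp add: hX_tensor[OF s] algebra_simps)
  finally show "pairing (deriv a) b c + 2 * pairing a (\<lambda>t. t * b t) (deriv c) = 0"
    using pairing_hX[OF assms] by simp
  have "pairing a (deriv b) c - 2 * pairing (\<lambda>t. t * a t) b (deriv c)
    = (LINT x|lebesgue. h x * tensor a (deriv b) c x - 2 * (h x * tensor (\<lambda>t. t * a t) b (deriv c) x))"
    by (simp add: pairing_def)
  also have "\<dots> = (LINT x|lebesgue. h x * hX 2 (tensor a b c) x)"
    by (simp add: hX_tensor[OF s] algebra_simps)
  finally show "pairing a (deriv b) c - 2 * pairing (\<lambda>t. t * a t) b (deriv c) = 0"
    using pairing_hX[OF assms] by simp
qed

text \<open>The factors \<open>1 *\<close> give the right side the shape expected by
  \<open>pairing_linear\<close>.\<close>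

lemma deriv_ident_mult: "smooth1 a \<Longrightarrow> deriv (\<lambda>t. t * a t) = (\<lambda>t. 1 * a t + 1 * (t * deriv a t))"
  by (rule ext, rule DERIV_imp_deriv) (auto intro!: derivative_eq_intros smooth1_DERIV)

text \<open>The vertical derivative comes from the commutator \<open>[X\<^sub>1, X\<^sub>2] = -4 \<partial>\<^sub>3\<close>; the horizontal ones follow.\<close>

lemma pairing_deriv_eq_0:
  assumes abc: "compact_smooth1 a" "compact_smooth1 b" "compact_smooth1 c"
  shows "pairing a b (deriv c) = 0" "pairing (deriv a) b c = 0" "pairing a (deriv b) c = 0"
proof -
  have 3: "pairing a b (deriv c) = 0"
    if [simp]: "compact_smooth1 a" "compact_smooth1 b" "compact_smooth1 c" for a b c
  proof -
    note [simp] = compact_smooth1_deriv compact_smooth1_ident_mult compact_smooth1_smooth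
    \<comment> \<open>Write P for \<open>pairing\<close>. The X_1 equation for (a, b', c) minus the
      X_2 equation for (a', b, c) cancels P(a', b', c) and gives P(a, t b', c') + P(t a', b, c') =
      0. The X_1 equation for (t a, b, c') plus the X_2 equation for (a, t b, c') cancels the terms
      with c'' and gives 2 P(a, b, c') plus the same sum.\<close>
    have "pairing (deriv a) (deriv b) c + 2 * pairing a (\<lambda>t. t * deriv b t) (deriv c) = 0"
      by (rule pairing_X) simp_all
    moreover have "pairing (deriv (\<lambda>t. t * a t)) b (deriv c)
        + 2 * pairing (\<lambda>t. t * a t) (\<lambda>t. t * b t) (deriv (deriv c)) = 0"
      by (rule pairing_X) simp_all
    moreover have "pairing (deriv (\<lambda>t. t * a t)) b (deriv c)
        = 1 * pairing a b (deriv c) + 1 * pairing (\<lambda>t. t * deriv a t) b (deriv c)"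
      unfolding deriv_ident_mult[OF compact_smooth1_smooth[OF that(1)]] by (rule pairing_linear) simp_all
    moreover have "pairing (deriv a) (deriv b) c - 2 * pairing (\<lambda>t. t * deriv a t) b (deriv c) = 0"
      by (rule pairing_X) simp_all
    moreover have "pairing a (deriv (\<lambda>t. t * b t)) (deriv c)
        - 2 * pairing (\<lambda>t. t * a t) (\<lambda>t. t * b t) (deriv (deriv c)) = 0"
      by (rule pairing_X) simp_all
    moreover have "pairing a (deriv (\<lambda>t. t * b t)) (deriv c)
        = 1 * pairing a b (deriv c) + 1 * pairing a (\<lambda>t. t * deriv b t) (deriv c)"
      unfolding deriv_ident_mult[OF compact_smooth1_smooth[OF that(2)]] by (rule pairing_linear) simp_all
    ultimately show ?thesis by linarith
  qed
  show "pairing a b (deriv c) = 0" by (rule 3[OF abc])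
  show "pairing (deriv a) b c = 0" "pairing a (deriv b) c = 0"
    using pairing_X[OF abc] 3[OF abc(1) compact_smooth1_ident_mult[OF abc(2)] abc(3)]
      3[OF compact_smooth1_ident_mult[OF abc(1)] abc(2,3)] by simp_all
qed

text \<open>Every factor is a derivative plus a multiple of \<open>eta\<close>, and the pairing
  annihilates derivatives in each slot. Replacing the factors in turn reduces any pairing to a
  multiple of the one of three copies of \<open>eta\<close>.\<close>

lemma pairing_eq_0:
  assumes zero: "pairing eta eta eta = 0"
    and abc: "compact_smooth1 a" "compact_smooth1 b" "compact_smooth1 c"
  shows "pairing a b c = 0"
proof -
  note e = compact_smooth1_eta
  have a: "pairing a eta eta = 0" if a: "compact_smooth1 a" for a
  proof -
    obtain C r where C: "compact_smooth1 C" "a = (\<lambda>t. deriv C t + r * eta t)"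
      by (rule compact_smooth1_decompose[OF a])
    show ?thesis
      using pairing_linear(1)[OF compact_smooth1_deriv[OF C(1)] e e e, of 1 r] pairing_deriv_eq_0(2)[OF C(1) e e] zero
      by (simp add: C(2))
  qed
  have b: "pairing a b eta = 0" if ab: "compact_smooth1 a" "compact_smooth1 b" for a b
  proof -
    obtain C r where C: "compact_smooth1 C" "b = (\<lambda>t. deriv C t + r * eta t)"
      by (rule compact_smooth1_decompose[OF ab(2)])
    show ?thesis
      using pairing_linear(2)[OF compact_smooth1_deriv[OF C(1)] e ab(1) e, of 1 r] pairing_deriv_eq_0(3)[OF ab(1) C(1) e] a[OF ab(1)]
      by (simp add: C(2))
  qed
  obtain C r where C: "compact_smooth1 C" "c = (\<lambda>t. deriv C t + r * eta t)"
    by (rule compact_smooth1_decompose[OF abc(3)])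
  show ?thesis
    using pairing_linear(3)[OF compact_smooth1_deriv[OF C(1)] e abc(1,2), of 1 r] pairing_deriv_eq_0(1)[OF abc(1,2) C(1)] b[OF abc(1,2)]
    by (simp add: C(2))
qed

lemma AE_box_zero_of_pairing_zero:
  assumes "pairing eta eta eta = 0"
  shows "AE x in lebesgue_on (box 0 (vec 2)). h x = 0"
proof (rule AE_zero_of_bump_box_integrals)
  let ?B = "box 0 (vec 2) :: heis set"
  have "locally_integrable UNIV h" using H1perD(3)[OF h] by (simp add: is_weak_X_def)
  then show "locally_integrable ?B h" by (simp add: locally_integrable_def)
  fix n and p q :: heis assume sub: "cbox p q \<subseteq> ?B"
  have B: "?B \<in> sets lebesgue" by simp
  have ind: "indicator ?B x *\<^sub>R (h x * bump_box n p q x) = h x * bump_box n p q x" for x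
    using bump_box_eq_0[of x p q n] sub box_subset_cbox[of p q] by (cases "x \<in> ?B") auto
  have "(LINT x|lebesgue_on ?B. h x * bump_box n p q x)
      = (LINT x|lebesgue. indicator ?B x *\<^sub>R (h x * bump_box n p q x))"
    by (rule integral_restrict_space) simp
  then have eq: "(LINT x|lebesgue_on ?B. h x * bump_box n p q x) = (LINT x|lebesgue. h x * bump_box n p q x)"
    unfolding ind .
  show "(LINT x|lebesgue_on ?B. h x * bump_box n p q x) = 0"
  proof (cases "cbox p q = {}")
    \<comment> \<open>An empty closed box is contained in the cell whatever its corners are, so
      nothing is known about \<open>p\<close> and \<open>q\<close>; but then the bump is identically
      zero.\<close>
    case True
    then have "bump_box n p q x = 0" for x using bump_box_eq_0 box_subset_cbox by blast
    then show ?thesis by simp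
  next
    case False
    then have "p \<in> cbox p q" "q \<in> cbox p q" by (auto simp: interval_ne_empty_cart mem_box_cart)
    then have "p \<in> ?B" "q \<in> ?B" using sub by blast+
    then have "0 < p $ i" "q $ i < 2" for i by (simp_all add: mem_box_cart)
    then have "pairing (bump n (p$1) (q$1)) (bump n (p$2) (q$2)) (bump n (p$3) (q$3)) = 0"
      by (intro pairing_eq_0[OF assms] compact_smooth1_bump)
    then show ?thesis unfolding eq by (simp add: pairing_def bump_box_def)
  qed
qed (rule open_box)

end

section \<open>From the cell to the whole space by lattice translations\<close>

lemma AE_Ycell_of_AE_box:
  assumes "AE y in lebesgue_on (box 0 (vec 2)). P y"
  shows "AE y in lebesgue. y \<in> Ycell \<longrightarrow> P y"
proof -
  have "AE y in lebesgue. y \<in> box 0 (vec 2) \<longrightarrow> P y"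
    using assms by (simp add: AE_restrict_space_iff)
  moreover have "AE y in lebesgue. y \<notin> cbox 0 (vec 2) - box (0::heis) (vec 2)"
    by (rule AE_not_in) (simp add: negligible_iff_null_sets[symmetric] negligible_frontier_interval)
  ultimately show ?thesis by eventually_elim (use Ycell_subset_cbox in blast)
qed

lemma heis_mult_nth:
  "(p \<cdot>\<^sub>H q) $ 1 = p $ 1 + q $ 1" "(p \<cdot>\<^sub>H q) $ 2 = p $ 2 + q $ 2"
  "(p \<cdot>\<^sub>H q) $ 3 = p $ 3 + q $ 3 + 2 * (p $ 2 * q $ 1 - p $ 1 * q $ 2)"
  by (simp_all add: heis_mult_def vector_3)

text \<open>The group law shears the third coordinate by an amount depending on \<open>k1\<close>
  and \<open>k2\<close>. These are therefore fixed first, and \<open>k3\<close> is the floor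
  correction of the sheared coordinate \<open>s\<close>.\<close>

lemma ex_lattice_translate_in_Ycell:
  "\<exists>k1 k2 k3. lattice_pt (vector [k1, k2, k3]) \<cdot>\<^sub>H x \<in> Ycell"
proof -
  have floor: "0 \<le> 2 * real_of_int (- \<lfloor>s / 2\<rfloor>) + s" "2 * real_of_int (- \<lfloor>s / 2\<rfloor>) + s < 2" for s
    using floor_correct[of "s / 2"] by linarith+
  define k1 k2 where "k1 = - \<lfloor>x $ 1 / 2\<rfloor>" and "k2 = - \<lfloor>x $ 2 / 2\<rfloor>"
  define s where "s = x $ 3 + 2 * (2 * real_of_int k2 * x $ 1 - 2 * real_of_int k1 * x $ 2)"
  define k3 where "k3 = - \<lfloor>s / 2\<rfloor>"
  have "lattice_pt (vector [k1, k2, k3]) \<cdot>\<^sub>H x \<in> Ycell"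
    using floor[of "x $ 1"] floor[of "x $ 2"] floor[of s]
    unfolding Ycell_def mem_Collect_eq forall_3 heis_mult_nth lattice_pt_def vec_lambda_beta vector_3
      k1_def[symmetric] k2_def[symmetric] k3_def[symmetric] by (auto simp: s_def)
  then show ?thesis by blast
qed

text \<open>A left translation is affine with an injective linear part, a shear, and preimages of
  null sets under maps with injective derivative are null.\<close>

lemma negligible_heis_translate_vimage:
  assumes "negligible N" shows "negligible {x. p \<cdot>\<^sub>H x \<in> N}"
proof -
  define L :: "heis \<Rightarrow> heis" where "L x = vector [x $ 1, x $ 2, x $ 3 + 2 * (p $ 2 * x $ 1 - p $ 1 * x $ 2)]" for x
  have eq: "(\<lambda>x. p \<cdot>\<^sub>H x) = (\<lambda>x. p + L x)"
    by (auto simp: vec_eq_iff forall_3 heis_mult_nth L_def vector_3)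
  have "linear L" by (rule linearI) (auto simp: L_def vec_eq_iff forall_3 vector_3 algebra_simps)
  then have "(L has_derivative L) (at x within UNIV)" for x
    by (simp add: linear_conv_bounded_linear bounded_linear_imp_has_derivative)
  then have D: "((\<lambda>x. p \<cdot>\<^sub>H x) has_derivative L) (at x within UNIV)" for x
    unfolding eq by (auto intro!: derivative_eq_intros)
  have "inj L" by (rule injI) (auto simp: L_def vec_eq_iff forall_3 vector_3)
  from negligible_differentiable_vimage[OF assms, of UNIV "\<lambda>x. L", OF this D] show ?thesis by simp
qed

text \<open>Any point where \<open>f\<close> differs from \<open>c\<close> is moved by a lattice
  translation into the cell without changing the value, so the exceptional set lies in a countable
  union of preimages of the null set \<open>N\<close>.\<close>

lemma AE_const_of_AE_Ycell:
  assumes "Yperiodic f" and AE: "AE y in lebesgue. y \<in> Ycell \<longrightarrow> f y = c"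
  shows "AE y in lebesgue. f y = c"
proof -
  define N where "N = {y. \<not> (y \<in> Ycell \<longrightarrow> f y = c)}"
  have "N \<in> null_sets lebesgue" unfolding N_def
    using AE by (simp add: completion.AE_iff_null_sets)
  then have N: "negligible N" by (simp add: negligible_iff_null_sets)
  have "negligible (\<Union>k :: int \<times> int \<times> int. {x. lattice_pt (vector [fst k, fst (snd k), snd (snd k)]) \<cdot>\<^sub>H x \<in> N})"
    by (intro negligible_countable_Union) (auto intro!: negligible_heis_translate_vimage N)
  then have null: "(\<Union>k :: int \<times> int \<times> int. {x. lattice_pt (vector [fst k, fst (snd k), snd (snd k)]) \<cdot>\<^sub>H x \<in> N}) \<in> null_sets lebesgue"
    by (simp add: negligible_iff_null_sets)
  show ?thesis
  proof (rule AE_I'[OF null], rule subsetI)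
    fix x assume "x \<in> {x \<in> space lebesgue. f x \<noteq> c}"
    then have x: "f x \<noteq> c" by simp
    obtain k1 k2 k3 where k: "lattice_pt (vector [k1, k2, k3]) \<cdot>\<^sub>H x \<in> Ycell"
      using ex_lattice_translate_in_Ycell by blast
    moreover have "f (lattice_pt (vector [k1, k2, k3]) \<cdot>\<^sub>H x) = f x" using assms(1) by (simp add: Yperiodic_def)
    ultimately have "lattice_pt (vector [k1, k2, k3]) \<cdot>\<^sub>H x \<in> N" using x by (simp add: N_def)
    then show "x \<in> (\<Union>k :: int \<times> int \<times> int. {x. lattice_pt (vector [fst k, fst (snd k), snd (snd k)]) \<cdot>\<^sub>H x \<in> N})"
      by (intro UN_I[of "(k1, k2, k3)"]) auto
  qed
qed

text \<open>If the integral were zero, the continuous nonnegative integrand would vanish everywhere,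
  yet it is positive at the centre (1, 1, 1) of the cell.\<close>

lemma integral_tensor_eta_pos: "(LINT x|lebesgue. tensor eta eta eta x) > 0"
proof -
  have nn: "tensor eta eta eta x \<ge> 0" for x by (simp add: tensor_def eta_def bump_nonneg)
  have sm: "smooth1 eta" by (rule compact_smooth1_smooth[OF compact_smooth1_eta])
  obtain K where K: "compact K" "K \<subseteq> box 0 (vec 2)" "\<And>x. x \<notin> K \<Longrightarrow> tensor eta eta eta x = 0"
    by (rule compact_smooth1_tensor[OF compact_smooth1_eta compact_smooth1_eta compact_smooth1_eta]) (erule that; simp)
  have int: "integrable lebesgue (tensor eta eta eta)"
    by (rule integrable_continuous_compact_support(2)[OF continuous_tensor[OF sm sm sm] K(1,3)])
  have "(LINT x|lebesgue. tensor eta eta eta x) \<noteq> 0"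
  proof
    assume "(LINT x|lebesgue. tensor eta eta eta x) = 0"
    then have "AE x in lebesgue. tensor eta eta eta x = 0"
      using integral_nonneg_eq_0_iff_AE[OF int] nn by simp
    then have "AE x in lebesgue. x \<in> {x. tensor eta eta eta x = 0}" by simp
    then have "(\<chi> i. 1) \<in> {x. tensor eta eta eta x = 0}"
      by (rule mem_closed_if_AE_lebesgue[rotated])
        (intro closed_Collect_eq continuous_tensor sm continuous_on_const)
    then show False using bump_pos[of 1 "1/2" 1 "3/2"] by (simp add: tensor_def eta_def)
  qed
  moreover have "(LINT x|lebesgue. tensor eta eta eta x) \<ge> 0" using nn by (intro integral_nonneg_AE) simp
  ultimately show ?thesis by simp
qed

lemma AE_const_of_hgrad_eq_0:
  assumes f: "f \<in> H1per" and grad: "AE y in lebesgue_on Ycell. hgrad UNIV f y = 0"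
  shows "\<exists>c. AE y in lebesgue. f y = c"
proof -
  let ?I = "LINT x|lebesgue. tensor eta eta eta x"
  note e = compact_smooth1_eta
  have sm: "smooth1 eta" by (rule compact_smooth1_smooth[OF e])
  obtain K where K: "compact K" "K \<subseteq> box 0 (vec 2)" "\<And>x. x \<notin> K \<Longrightarrow> tensor eta eta eta x = 0"
    by (rule compact_smooth1_tensor[OF e e e]) (erule that; simp)
  have int: "integrable lebesgue (tensor eta eta eta)"
    by (rule integrable_continuous_compact_support(2)[OF continuous_tensor[OF sm sm sm] K(1,3)])
  \<comment> \<open>The mean of \<open>f\<close> weighted by the product of bumps: the choice for
    which \<open>f - c\<close> has zero pairing with that product.\<close>
  define c where "c = pairing f eta eta eta / ?I"
  define h where "h y = f y + (- c)" for y
  have h: "h \<in> H1per" unfolding h_def[abs_def] by (intro H1per_add H1per_const f)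
  have hg: "AE y in lebesgue_on Ycell. hgrad UNIV h y = 0"
    using grad hgrad_add_const_AE[OF f, of "- c"] unfolding h_def[abs_def] by eventually_elim simp
  have "pairing h eta eta eta = (LINT x|lebesgue. f x * tensor eta eta eta x - c * tensor eta eta eta x)"
    unfolding pairing_def[OF h hg] by (simp add: h_def algebra_simps)
  also have "\<dots> = pairing f eta eta eta - c * ?I"
    using integrable_pairing[OF f grad e e e] int by (simp add: pairing_def[OF f grad])
  also have "\<dots> = 0" using integral_tensor_eta_pos by (simp add: c_def)
  finally have "AE x in lebesgue_on (box 0 (vec 2)). h x = 0"
    by (rule AE_box_zero_of_pairing_zero[OF h hg])
  from AE_Ycell_of_AE_box[OF this] have "AE y in lebesgue. y \<in> Ycell \<longrightarrow> f y = c"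
    by (simp add: h_def)
  from AE_const_of_AE_Ycell[OF H1perD(1)[OF f] this] show ?thesis by blast
qed

subsection \<open>The energy of the cell\<close>

locale elliptic_matrix =
  fixes A :: "heis \<Rightarrow> real ^ 2 ^ 2" and \<alpha> \<beta> :: real
  assumes measurable_entry: "\<And>i j. (\<lambda>x. A x $ i $ j) \<in> borel_measurable lebesgue"
    and pos: "\<alpha> > 0" "\<beta> > 0"
    and bound: "\<And>x v. norm (A x *v v) \<le> \<beta> * norm v"
    and coercive: "\<And>x v. (A x *v v) \<bullet> v \<ge> \<alpha> * (norm v)\<^sup>2"
begin

lemma integrable_form:
  assumes "L2field v" "L2field w"
  shows "integrable (lebesgue_on Ycell) (\<lambda>y. (A y *v v y) \<bullet> w y)"
proof (rule Bochner_Integration.integrable_bound)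
  show "integrable (lebesgue_on Ycell) (\<lambda>y. \<beta> * ((norm (v y))\<^sup>2 + (norm (w y))\<^sup>2))"
    using L2field_integrable[OF assms(1)] L2field_integrable[OF assms(2)] by simp
  have "(\<lambda>y. A y $ i $ j * v y $ j * w y $ i) \<in> borel_measurable (lebesgue_on Ycell)" for i j
    using assms by (intro borel_measurable_times measurable_restrict_space1[OF measurable_entry])
      (auto simp: L2field_def L2_def)
  then have "(\<lambda>y. \<Sum>i\<in>UNIV. \<Sum>j\<in>UNIV. A y $ i $ j * v y $ j * w y $ i) \<in> borel_measurable (lebesgue_on Ycell)"
    by (intro borel_measurable_sum)
  then show "(\<lambda>y. (A y *v v y) \<bullet> w y) \<in> borel_measurable (lebesgue_on Ycell)"
    by (simp add: inner_vec_def matrix_vector_mult_def sum_distrib_right)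
  show "AE y in lebesgue_on Ycell. norm ((A y *v v y) \<bullet> w y) \<le> norm (\<beta> * ((norm (v y))\<^sup>2 + (norm (w y))\<^sup>2))"
  proof (intro AE_I2)
    fix y
    have "norm ((A y *v v y) \<bullet> w y) \<le> norm (A y *v v y) * norm (w y)"
      using Cauchy_Schwarz_ineq2 by simp
    also have "\<dots> \<le> (\<beta> * norm (v y)) * norm (w y)"
      by (intro mult_right_mono bound) simp
    also have "\<dots> \<le> \<beta> * ((norm (v y))\<^sup>2 + (norm (w y))\<^sup>2)"
    proof -
      have "0 \<le> norm (v y) * norm (w y)" by simp
      with sum_squares_bound[of "norm (v y)" "norm (w y)"]
      have "norm (v y) * norm (w y) \<le> (norm (v y))\<^sup>2 + (norm (w y))\<^sup>2" by linarith
      then show ?thesis using pos by (simp add: mult.assoc)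
    qed
    also have "\<dots> \<le> norm \<dots>" by simp
    finally show "norm ((A y *v v y) \<bullet> w y) \<le> norm (\<beta> * ((norm (v y))\<^sup>2 + (norm (w y))\<^sup>2))" .
  qed
qed

definition energy :: "(heis \<Rightarrow> real) \<Rightarrow> real" where
  "energy f = (LINT y|lebesgue_on Ycell. (A y *v hgrad UNIV f y) \<bullet> hgrad UNIV f y)"

lemma form_nonneg: "(A y *v v) \<bullet> v \<ge> 0"
  using coercive[of v y] pos by (smt (verit) mult_nonneg_nonneg zero_le_power2)

lemma energy_nonneg: "energy f \<ge> 0"
  unfolding energy_def by (intro integral_nonneg_AE AE_I2 form_nonneg)

text \<open>The difference of the two sides is the form at e v - w divided by e, which is
  nonnegative. For a nonsymmetric \<open>A\<close> the two mixed terms may differ, but only their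
  sum enters.\<close>

lemma form_add_le:
  assumes "e > 0"
  shows "(A y *v (v + w)) \<bullet> (v + w) \<le> (1 + e) * ((A y *v v) \<bullet> v) + (1 + 1 / e) * ((A y *v w) \<bullet> w)"
proof -
  have "0 \<le> (A y *v (e *\<^sub>R v - w)) \<bullet> (e *\<^sub>R v - w) / e"
    using assms by (intro divide_nonneg_pos form_nonneg)
  also have "\<dots> = e * ((A y *v v) \<bullet> v) - (A y *v v) \<bullet> w - (A y *v w) \<bullet> v + ((A y *v w) \<bullet> w) / e"
    using assms by (simp add: matrix_vector_mult_diff_distrib matrix_vector_mult_scaleR inner_diff_left inner_diff_right field_simps)
  finally show ?thesis
    by (simp add: matrix_vector_right_distrib inner_add_left inner_add_right algebra_simps)
qed

lemma sqrt_energy_triangle: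
  assumes f: "f \<in> H1per" and g: "g \<in> H1per"
  shows "sqrt (energy (\<lambda>y. f y + g y)) \<le> sqrt (energy f) + sqrt (energy g)"
proof (rule sqrt_le_add_sqrtI[OF energy_nonneg energy_nonneg])
  fix e :: real assume e: "e > 0"
  let ?M = "lebesgue_on Ycell"
  note [simp] = integrable_form[OF L2field_hgrad[OF f] L2field_hgrad[OF f]] integrable_form[OF L2field_hgrad[OF g] L2field_hgrad[OF g]]
  have "energy (\<lambda>y. f y + g y) \<le> (LINT y|?M. (1 + e) * ((A y *v hgrad UNIV f y) \<bullet> hgrad UNIV f y)
      + (1 + 1 / e) * ((A y *v hgrad UNIV g y) \<bullet> hgrad UNIV g y))"
    unfolding energy_def
  proof (rule integral_mono_AE)
    show "integrable ?M (\<lambda>y. (A y *v hgrad UNIV (\<lambda>y. f y + g y) y) \<bullet> hgrad UNIV (\<lambda>y. f y + g y) y)"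
      by (intro integrable_form L2field_hgrad H1per_add f g)
    show "AE y in ?M. (A y *v hgrad UNIV (\<lambda>y. f y + g y) y) \<bullet> hgrad UNIV (\<lambda>y. f y + g y) y
       \<le> (1 + e) * ((A y *v hgrad UNIV f y) \<bullet> hgrad UNIV f y) + (1 + 1 / e) * ((A y *v hgrad UNIV g y) \<bullet> hgrad UNIV g y)"
      using hgrad_linear_AE[OF f g, of 1 1] by eventually_elim (simp add: form_add_le[OF e])
  qed simp
  also have "\<dots> = (1 + e) * energy f + (1 + 1 / e) * energy g" by (simp add: energy_def)
  finally show "energy (\<lambda>y. f y + g y) \<le> (1 + e) * energy f + (1 + 1 / e) * energy g" .
qed

lemma sqrt_energy_le:
  assumes "f \<in> H1per" shows "sqrt (energy f) \<le> sqrt \<beta> * quot_norm f"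
proof -
  let ?M = "lebesgue_on Ycell"
  have "energy f \<le> (LINT y|?M. \<beta> * (norm (hgrad UNIV f y))\<^sup>2)"
    unfolding energy_def
  proof (rule integral_mono)
    fix y
    have "(A y *v hgrad UNIV f y) \<bullet> hgrad UNIV f y \<le> norm (A y *v hgrad UNIV f y) * norm (hgrad UNIV f y)"
      by (rule norm_cauchy_schwarz)
    also have "\<dots> \<le> (\<beta> * norm (hgrad UNIV f y)) * norm (hgrad UNIV f y)"
      by (intro mult_right_mono bound) simp
    finally show "(A y *v hgrad UNIV f y) \<bullet> hgrad UNIV f y \<le> \<beta> * (norm (hgrad UNIV f y))\<^sup>2"
      by (simp add: power2_eq_square mult.assoc)
  qed (use integrable_form L2field_integrable L2field_hgrad[OF assms] in auto)
  also have "\<dots> = \<beta> * (LINT y|?M. (norm (hgrad UNIV f y))\<^sup>2)" by simp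
  finally have "sqrt (energy f) \<le> sqrt \<beta> * sqrt (LINT y|?M. (norm (hgrad UNIV f y))\<^sup>2)"
    by (simp add: real_sqrt_mult[symmetric])
  also have "\<dots> \<le> sqrt \<beta> * quot_norm f"
    using pos by (intro mult_left_mono gradient_energy_le_quot_norm assms) simp
  finally show ?thesis .
qed

lemma sqrt_energy_abs_diff:
  assumes "f \<in> H1per" "g \<in> H1per"
  shows "\<bar>sqrt (energy f) - sqrt (energy g)\<bar> \<le> sqrt \<beta> * quot_norm (\<lambda>y. f y - g y)"
  by (rule abs_diff_le_of_triangle[OF sqrt_energy_triangle sqrt_energy_le assms])

lemma hgrad_eq_0_of_energy_eq_0:
  assumes f: "f \<in> H1per" and "energy f = 0"
  shows "AE y in lebesgue_on Ycell. hgrad UNIV f y = 0"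
proof -
  have "AE y in lebesgue_on Ycell. (A y *v hgrad UNIV f y) \<bullet> hgrad UNIV f y = 0"
    using integral_nonneg_eq_0_iff_AE[OF integrable_form[OF L2field_hgrad[OF f] L2field_hgrad[OF f]]] assms(2)
    by (simp add: energy_def form_nonneg)
  then show ?thesis
  proof eventually_elim
    case (elim y)
    then have "\<alpha> * (norm (hgrad UNIV f y))\<^sup>2 \<le> 0" using coercive[of "hgrad UNIV f y" y] by simp
    then show ?case using pos by (simp add: mult_le_0_iff)
  qed
qed

end

subsection \<open>Square-integrable maps into the quotient\<close>

text \<open>Separated from \<open>L2_H1per_quot\<close> because the square integrability of the
  quotient norm itself presupposes its measurability, which is deduced from this clause.\<close>

definition strongly_measurable :: "heis set \<Rightarrow> (heis \<Rightarrow> heis \<Rightarrow> real) \<Rightarrow> bool" where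
  "strongly_measurable \<Omega> w \<longleftrightarrow> (\<exists>s :: nat \<Rightarrow> heis \<Rightarrow> heis \<Rightarrow> real.
        (\<forall>n. simple_function (lebesgue_on \<Omega>) (s n) \<and> s n ` \<Omega> \<subseteq> H1per) \<and>
        (AE x in lebesgue_on \<Omega>. (\<lambda>n. quot_norm (\<lambda>y. s n x y - w x y)) \<longlonglongrightarrow> 0))"

text \<open>Composing \<open>p\<close> with the simple approximants gives simple real functions, and
  the Lipschitz bound makes them converge to \<open>p (w x)\<close> almost everywhere.\<close>

lemma strongly_measurable_functional:
  assumes Om: "\<Omega> \<in> sets lebesgue" and w: "\<And>x. x \<in> \<Omega> \<Longrightarrow> w x \<in> H1per" and sm: "strongly_measurable \<Omega> w"
    and p: "\<And>f g. f \<in> H1per \<Longrightarrow> g \<in> H1per \<Longrightarrow> \<bar>p f - p g\<bar> \<le> C * quot_norm (\<lambda>y. f y - g y)"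
  shows "(\<lambda>x. p (w x) :: real) \<in> borel_measurable (lebesgue_on \<Omega>)"
proof -
  obtain s :: "nat \<Rightarrow> heis \<Rightarrow> heis \<Rightarrow> real" where s: "\<And>n. simple_function (lebesgue_on \<Omega>) (s n)" "\<And>n. s n ` \<Omega> \<subseteq> H1per"
    "AE x in lebesgue_on \<Omega>. (\<lambda>n. quot_norm (\<lambda>y. s n x y - w x y)) \<longlonglongrightarrow> 0"
    using sm unfolding strongly_measurable_def by blast
  have "(\<lambda>x. p (s n x)) \<in> borel_measurable (lebesgue_on \<Omega>)" for n
    using simple_function_compose[OF s(1)[of n], of p] by (intro borel_measurable_simple_function) (simp add: comp_def)
  then have lim: "(\<lambda>x. lim (\<lambda>n. p (s n x))) \<in> borel_measurable (lebesgue_on \<Omega>)"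
    by (rule borel_measurable_lim_metric)
  have "AE x in lebesgue_on \<Omega>. x \<in> \<Omega>" by (rule AE_I2) simp
  with s(3) have "AE x in lebesgue_on \<Omega>. lim (\<lambda>n. p (s n x)) = p (w x)"
  proof eventually_elim
    case (elim x)
    have "(\<lambda>n. p (s n x) - p (w x)) \<longlonglongrightarrow> 0"
    proof (rule Lim_null_comparison)
      show "\<forall>\<^sub>F n in sequentially. norm (p (s n x) - p (w x)) \<le> C * quot_norm (\<lambda>y. s n x y - w x y)"
        using p[OF _ w[OF elim(2)]] s(2) elim(2) by (auto intro!: always_eventually)
      show "(\<lambda>n. C * quot_norm (\<lambda>y. s n x y - w x y)) \<longlonglongrightarrow> 0"
        using tendsto_mult[OF tendsto_const elim(1), of C] by simp
    qed
    then have "(\<lambda>n. p (s n x)) \<longlonglongrightarrow> p (w x)" by (rule LIM_zero_cancel)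
    then show ?case by (rule limI)
  qed
  from borel_measurable_lebesgue_on_cong_AE[OF Om lim this] show ?thesis .
qed

lemma L2_H1per_quot_iff:
  "w \<in> L2_H1per_quot \<Omega> \<longleftrightarrow> (\<forall>x\<in>\<Omega>. w x \<in> H1per) \<and> strongly_measurable \<Omega> w
     \<and> integrable (lebesgue_on \<Omega>) (\<lambda>x. (quot_norm (w x))\<^sup>2)"
  unfolding L2_H1per_quot_def strongly_measurable_def by blast

lemma quot_norm_zero: "quot_norm (\<lambda>y. 0) = 0"
  using quot_norm_scale_le[OF H1per_const, of 0 0] quot_norm_nonneg[OF H1per_const, of 0] by simp

lemma zero_in_L2_H1per_quot: "(\<lambda>x y. 0) \<in> L2_H1per_quot \<Omega>"
  unfolding L2_H1per_quot_iff strongly_measurable_def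
  by (intro conjI exI[of _ "\<lambda>n x y. 0"]) (auto simp: quot_norm_zero H1per_const)

text \<open>Simple approximants of \<open>w\<close> and of \<open>g\<close> combine to simple
  approximants of the difference; the error is at most the one for \<open>w\<close> plus that for
  \<open>g\<close> times the norm of \<open>Z\<close>. Applied once for each cell solution, it makes
  the corrector defect an admissible test function.\<close>

lemma L2_H1per_quot_diff_scale:
  assumes Om: "\<Omega> \<in> sets lebesgue" and w: "w \<in> L2_H1per_quot \<Omega>" and Z: "Z \<in> H1per" and g: "g \<in> L2 \<Omega>"
  shows "(\<lambda>x y. w x y - g x * Z y) \<in> L2_H1per_quot \<Omega>"
proof -
  let ?w = "\<lambda>x y. w x y - g x * Z y"
  have wx: "\<And>x. x \<in> \<Omega> \<Longrightarrow> w x \<in> H1per" and int: "integrable (lebesgue_on \<Omega>) (\<lambda>x. (quot_norm (w x))\<^sup>2)"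
    using w by (auto simp: L2_H1per_quot_iff)
  obtain s :: "nat \<Rightarrow> heis \<Rightarrow> heis \<Rightarrow> real" where s: "\<And>n. simple_function (lebesgue_on \<Omega>) (s n)" "\<And>n. s n ` \<Omega> \<subseteq> H1per"
    "AE x in lebesgue_on \<Omega>. (\<lambda>n. quot_norm (\<lambda>y. s n x y - w x y)) \<longlonglongrightarrow> 0"
    using w unfolding L2_H1per_quot_iff strongly_measurable_def by blast
  obtain c where c: "\<And>n. simple_function (lebesgue_on \<Omega>) (c n)" "\<And>x. x \<in> \<Omega> \<Longrightarrow> (\<lambda>n. c n x) \<longlonglongrightarrow> g x"
    using borel_measurable_implies_sequence_metric[OF L2_measurable[OF g], of 0] by auto
  have wH: "?w x \<in> H1per" if "x \<in> \<Omega>" for x by (intro H1per_diff H1per_scale wx Z that)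
  have "simple_function (lebesgue_on \<Omega>) (\<lambda>x y. s n x y - c n x * Z y)" for n
    using simple_function_compose2[OF s(1)[of n] c(1)[of n], of "\<lambda>f r y. f y - r * Z y"] .
  moreover have "(\<lambda>x y. s n x y - c n x * Z y) ` \<Omega> \<subseteq> H1per" for n
    using s(2)[of n] by (auto intro!: H1per_diff H1per_scale Z)
  moreover have "AE x in lebesgue_on \<Omega>. (\<lambda>n. quot_norm (\<lambda>y. (s n x y - c n x * Z y) - ?w x y)) \<longlonglongrightarrow> 0"
  proof -
    have "AE x in lebesgue_on \<Omega>. x \<in> \<Omega>" by (rule AE_I2) simp
    with s(3) show ?thesis
    proof eventually_elim
      case (elim x)
      have sx: "s n x \<in> H1per" for n using s(2) elim(2) by blast
      show ?case
      proof (rule Lim_null_comparison)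
        show "(\<lambda>n. quot_norm (\<lambda>y. s n x y - w x y) + \<bar>g x - c n x\<bar> * H1per_norm Z) \<longlonglongrightarrow> 0"
          using tendsto_add[OF elim(1) tendsto_mult[OF tendsto_rabs[OF tendsto_diff[OF tendsto_const[of "g x"] c(2)[OF elim(2)]]]
                tendsto_const[of "H1per_norm Z"]]] by simp
        have "quot_norm (\<lambda>y. (s n x y - c n x * Z y) - ?w x y)
            \<le> quot_norm (\<lambda>y. s n x y - w x y) + \<bar>g x - c n x\<bar> * H1per_norm Z" for n
        proof -
          have "(\<lambda>y. (s n x y - c n x * Z y) - ?w x y) = (\<lambda>y. (s n x y - w x y) + (g x - c n x) * Z y)"
            by (simp add: algebra_simps)
          then show ?thesis
            using quot_norm_triangle[OF H1per_diff[OF sx wx[OF elim(2)]] H1per_scale[OF Z], of n "g x - c n x"]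
              quot_norm_scale_le[OF Z, of "g x - c n x"] by simp
        qed
        moreover have "quot_norm (\<lambda>y. (s n x y - c n x * Z y) - ?w x y) \<ge> 0" for n
          by (intro quot_norm_nonneg H1per_diff H1per_scale sx wx elim(2) Z)
        ultimately show "\<forall>\<^sub>F n in sequentially. norm (quot_norm (\<lambda>y. (s n x y - c n x * Z y) - ?w x y))
          \<le> quot_norm (\<lambda>y. s n x y - w x y) + \<bar>g x - c n x\<bar> * H1per_norm Z"
          by (intro always_eventually allI) simp
      qed
    qed
  qed
  ultimately have sm: "strongly_measurable \<Omega> ?w"
    unfolding strongly_measurable_def by (intro exI[of _ "\<lambda>n x y. s n x y - c n x * Z y"] conjI allI)
  have meas: "(\<lambda>x. quot_norm (?w x)) \<in> borel_measurable (lebesgue_on \<Omega>)"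
    by (rule strongly_measurable_functional[OF Om wH sm quot_norm_abs_diff])
  have "integrable (lebesgue_on \<Omega>) (\<lambda>x. (quot_norm (?w x))\<^sup>2)"
  proof (rule Bochner_Integration.integrable_bound)
    show "integrable (lebesgue_on \<Omega>) (\<lambda>x. 2 * (quot_norm (w x))\<^sup>2 + 2 * ((H1per_norm Z)\<^sup>2 * (g x)\<^sup>2))"
      using int L2_integrable[OF g] by simp
    show "(\<lambda>x. (quot_norm (?w x))\<^sup>2) \<in> borel_measurable (lebesgue_on \<Omega>)" using meas by simp
    show "AE x in lebesgue_on \<Omega>. norm ((quot_norm (?w x))\<^sup>2)
        \<le> norm (2 * (quot_norm (w x))\<^sup>2 + 2 * ((H1per_norm Z)\<^sup>2 * (g x)\<^sup>2))"
    proof (rule AE_I2)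
      fix x assume "x \<in> space (lebesgue_on \<Omega>)"
      then have x: "x \<in> \<Omega>" by simp
      have "(\<lambda>y. w x y + (- g x) * Z y) = ?w x" by simp
      then have "quot_norm (?w x) \<le> quot_norm (w x) + \<bar>g x\<bar> * H1per_norm Z"
        using quot_norm_triangle[OF wx[OF x] H1per_scale[OF Z], of "- g x"] quot_norm_scale_le[OF Z, of "- g x"] by simp
      then have "(quot_norm (?w x))\<^sup>2 \<le> (quot_norm (w x) + \<bar>g x\<bar> * H1per_norm Z)\<^sup>2"
        by (intro power_mono quot_norm_nonneg wH x)
      \<comment> \<open>Both constants 2 come from the weighted square inequality with weight
        1.\<close>
      also have "\<dots> \<le> 2 * (quot_norm (w x))\<^sup>2 + 2 * ((H1per_norm Z)\<^sup>2 * (g x)\<^sup>2)"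
        using square_add_le[of 1 "quot_norm (w x)" "\<bar>g x\<bar> * H1per_norm Z"] by (simp add: power_mult_distrib mult.commute)
      finally show "norm ((quot_norm (?w x))\<^sup>2) \<le> norm (2 * (quot_norm (w x))\<^sup>2 + 2 * ((H1per_norm Z)\<^sup>2 * (g x)\<^sup>2))"
        by simp
    qed
  qed
  then show ?thesis unfolding L2_H1per_quot_iff using sm wH by simp
qed

subsection \<open>The corrector and the effective equation\<close>

text \<open>If one integrand fails to be measurable, so does the other, and both integrals take the
  default value 0. Hence the lemma also covers inner integrals whose measurability in
  \<open>x\<close> is unknown.\<close>

lemma integral_lebesgue_on_cong_AE:
  fixes f g :: "'a::euclidean_space \<Rightarrow> real"
  assumes S: "S \<in> sets lebesgue" and eq: "AE x in lebesgue_on S. f x = g x"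
  shows "(LINT x|lebesgue_on S. f x) = (LINT x|lebesgue_on S. g x)"
proof (cases "f \<in> borel_measurable (lebesgue_on S)")
  case True
  then show ?thesis
    using borel_measurable_lebesgue_on_cong_AE[OF S True eq] eq by (intro integral_cong_AE)
next
  case False
  then have "g \<notin> borel_measurable (lebesgue_on S)"
    using borel_measurable_lebesgue_on_cong_AE[OF S _ AE_symmetric[OF eq]] by blast
  with False have "\<not> integrable (lebesgue_on S) f" "\<not> integrable (lebesgue_on S) g"
    using borel_measurable_integrable by blast+
  then show ?thesis by (simp add: not_integrable_integral_eq)
qed

lemma is_weak_X_zero: "is_weak_X i \<Omega> (\<lambda>x. 0) (\<lambda>x. 0)"
  by (simp add: is_weak_X_def locally_integrable_const)

lemma zero_in_H1: "(\<lambda>x. 0) \<in> H1 \<Omega>"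
  unfolding H1_def using L2_zero is_weak_X_zero by blast

lemma hgrad_zero_AE: "open \<Omega> \<Longrightarrow> AE x in lebesgue_on \<Omega>. hgrad \<Omega> (\<lambda>x. 0) x = 0"
proof -
  assume Om: "open \<Omega>"
  from wX_eq_AE[OF Om is_weak_X_zero, of 1] wX_eq_AE[OF Om is_weak_X_zero, of 2]
  show ?thesis by eventually_elim (simp add: hgrad_def vec_eq_iff forall_2)
qed

lemma wX_in_L2:
  assumes Om: "open \<Omega>" and u: "u \<in> H1 \<Omega>"
  shows "wX i \<Omega> u \<in> L2 \<Omega>"
proof -
  obtain g where g: "is_weak_X i \<Omega> u g" "g \<in> L2 \<Omega>" using u by (auto simp: H1_def)
  show ?thesis
    by (rule L2_cong_AE[OF _ g(2) AE_symmetric[OF wX_eq_AE[OF Om g(1)]]]) (use Om in simp)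
qed

lemma integrable_matrix_of_entries:
  fixes F :: "'a \<Rightarrow> real ^ 2 ^ 2"
  assumes "\<And>i j. integrable M (\<lambda>y. F y $ i $ j)"
  shows "integrable M F"
proof -
  have eq: "(\<lambda>y. \<Sum>i\<in>UNIV. \<Sum>j\<in>UNIV. F y $ i $ j *\<^sub>R axis i (axis j (1::real))) = F"
    by (auto simp: vec_eq_iff forall_2 sum_2 axis_def)
  have "integrable M (\<lambda>y. \<Sum>i\<in>UNIV. \<Sum>j\<in>UNIV. F y $ i $ j *\<^sub>R axis i (axis j (1::real)))"
    by (intro Bochner_Integration.integrable_sum integrable_scaleR_left impI assms)
  then show ?thesis unfolding eq .
qed

lemma bounded_linear_matrix_form:
  "bounded_linear (\<lambda>M :: real ^ 2 ^ 2. (M *v v) \<bullet> \<psi>)"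
  unfolding linear_conv_bounded_linear[symmetric]
  by (rule linearI) (simp_all add: matrix_vector_mult_def inner_vec_def sum_2 algebra_simps)

context elliptic_matrix
begin

lemma cell_solution_form:
  assumes Z: "cell_solution A i Z" and \<xi>: "\<xi> \<in> H1per"
  shows "(LINT y|lebesgue_on Ycell. (A y *v (axis i 1 + hgrad UNIV Z y)) \<bullet> hgrad UNIV \<xi> y) = 0"
proof -
  have "Z \<in> H1per" and eq: "(LINT y|lebesgue_on Ycell. (A y *v hgrad UNIV Z y) \<bullet> hgrad UNIV \<xi> y)
        = - (LINT y|lebesgue_on Ycell. (A y *v axis i 1) \<bullet> hgrad UNIV \<xi> y)"
    using assms by (auto simp: cell_solution_def)
  then show ?thesis
    using integrable_form[OF L2field_hgrad L2field_hgrad, of Z \<xi>] integrable_form[OF L2field_const L2field_hgrad, of \<xi> "axis i 1"] \<xi>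
    by (simp add: matrix_vector_right_distrib inner_add_left)
qed

text \<open>The map \<open>M \<mapsto> (M *v v) \<bullet> \<psi>\<close> is linear and commutes with
  the matrix-valued integral once the latter converges. Convergence is checked by entries: entry (i,
  j) is the form of the field \<open>axis j 1 + hgrad UNIV (Z j) y\<close> against the constant
  \<open>axis i 1\<close>.\<close>

lemma effective_matrix_form:
  assumes Z: "\<And>i. Z i \<in> H1per"
  shows "(effective_matrix A Z *v v) \<bullet> \<psi>
    = (LINT y|lebesgue_on Ycell. (A y *v (v + (v $ 1 *\<^sub>R hgrad UNIV (Z 1) y + v $ 2 *\<^sub>R hgrad UNIV (Z 2) y))) \<bullet> \<psi>)"
proof -
  let ?D = "\<lambda>y. \<chi> i j. wX i UNIV (Z j) y :: real ^ 2 ^ 2"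
  have "integrable (lebesgue_on Ycell) (\<lambda>y. (A y ** (mat 1 + ?D y)) $ i $ j)" for i j
  proof -
    have "L2field (\<lambda>y. 1 *\<^sub>R axis j 1 + 1 *\<^sub>R hgrad UNIV (Z j) y)"
      by (intro L2field_linear L2field_const L2field_hgrad Z)
    moreover have "(\<lambda>y. (A y *v (1 *\<^sub>R axis j 1 + 1 *\<^sub>R hgrad UNIV (Z j) y)) \<bullet> axis i 1)
        = (\<lambda>y. (A y ** (mat 1 + ?D y)) $ i $ j)"
      unfolding inner_axis using exhaust_2[of j]
      by (auto simp: matrix_vector_mult_def matrix_matrix_mult_def hgrad_def mat_def axis_def sum_2)
    ultimately show ?thesis
      using integrable_form[OF _ L2field_const, of "\<lambda>y. 1 *\<^sub>R axis j 1 + 1 *\<^sub>R hgrad UNIV (Z j) y" "axis i 1"] by simp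
  qed
  then have "integrable (lebesgue_on Ycell) (\<lambda>y. A y ** (mat 1 + ?D y))"
    by (rule integrable_matrix_of_entries)
  from integral_bounded_linear[OF bounded_linear_matrix_form this, of v \<psi>]
  have "(effective_matrix A Z *v v) \<bullet> \<psi> = (LINT y|lebesgue_on Ycell. ((A y ** (mat 1 + ?D y)) *v v) \<bullet> \<psi>)"
    by (simp add: effective_matrix_def)
  also have "\<dots> = (LINT y|lebesgue_on Ycell. (A y *v (v + (v $ 1 *\<^sub>R hgrad UNIV (Z 1) y + v $ 2 *\<^sub>R hgrad UNIV (Z 2) y))) \<bullet> \<psi>)"
  proof (rule Bochner_Integration.integral_cong[OF refl])
    fix y
    have "(mat 1 + ?D y) *v v = v + (v $ 1 *\<^sub>R hgrad UNIV (Z 1) y + v $ 2 *\<^sub>R hgrad UNIV (Z 2) y)"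
      unfolding matrix_vector_mult_add_rdistrib
      by (simp add: vec_eq_iff forall_2 matrix_vector_mult_def hgrad_def sum_2 mat_def)
    then show "((A y ** (mat 1 + ?D y)) *v v) \<bullet> \<psi>
        = (A y *v (v + (v $ 1 *\<^sub>R hgrad UNIV (Z 1) y + v $ 2 *\<^sub>R hgrad UNIV (Z 2) y))) \<bullet> \<psi>"
      by (simp add: matrix_vector_mul_assoc[symmetric])
  qed
  finally show ?thesis .
qed

text \<open>Here \<open>v\<close> stands for the gradient of \<open>u\<close> at a fixed point. The
  terms other than the gradient of \<open>w\<close> combine to the sum of v_i (e_i + grad Z_i), and
  each summand is annihilated by the cell problem tested with \<open>w\<close>.\<close>

lemma corrector_defect_form:
  assumes Z: "\<And>i. cell_solution A i (Z i)" and w: "w \<in> H1per"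
  shows "(LINT y|lebesgue_on Ycell. (A y *v (v + (hgrad UNIV w y + v $ 1 *\<^sub>R hgrad UNIV (Z 1) y + v $ 2 *\<^sub>R hgrad UNIV (Z 2) y)))
      \<bullet> hgrad UNIV w y) = energy w"
proof -
  let ?M = "lebesgue_on Ycell"
  have ZH: "Z i \<in> H1per" for i using Z[of i] by (simp add: cell_solution_def)
  define q where "q i y = (A y *v (axis i 1 + hgrad UNIV (Z i) y)) \<bullet> hgrad UNIV w y" for i y
  have "L2field (\<lambda>y. 1 *\<^sub>R axis i 1 + 1 *\<^sub>R hgrad UNIV (Z i) y)" for i
    by (intro L2field_linear L2field_const L2field_hgrad ZH)
  then have [simp]: "integrable ?M (q i)" for i
    unfolding q_def using integrable_form[OF _ L2field_hgrad[OF w]] by simp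
  have [simp]: "integrable ?M (\<lambda>y. (A y *v hgrad UNIV w y) \<bullet> hgrad UNIV w y)"
    by (intro integrable_form L2field_hgrad w)
  have v: "v = v $ 1 *\<^sub>R axis 1 1 + v $ 2 *\<^sub>R axis 2 1"
    by (simp add: vec_eq_iff forall_2 axis_def)
  have "(A y *v (v + (hgrad UNIV w y + v $ 1 *\<^sub>R hgrad UNIV (Z 1) y + v $ 2 *\<^sub>R hgrad UNIV (Z 2) y))) \<bullet> hgrad UNIV w y
      = (A y *v hgrad UNIV w y) \<bullet> hgrad UNIV w y + v $ 1 * q 1 y + v $ 2 * q 2 y" for y
    unfolding q_def
    by (subst (1) v) (simp add: matrix_vector_right_distrib matrix_vector_mult_scaleR inner_add_left algebra_simps)
  then have "(LINT y|?M. (A y *v (v + (hgrad UNIV w y + v $ 1 *\<^sub>R hgrad UNIV (Z 1) y + v $ 2 *\<^sub>R hgrad UNIV (Z 2) y)))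
      \<bullet> hgrad UNIV w y) = energy w + v $ 1 * (LINT y|?M. q 1 y) + v $ 2 * (LINT y|?M. q 2 y)"
    by (simp add: energy_def)
  then show ?thesis using cell_solution_form[OF Z w] by (simp add: q_def)
qed

end

theorem mainTheorem3:
  fixes \<Omega> :: "heis set"
    and f u :: "heis \<Rightarrow> real"
    and A :: "heis \<Rightarrow> real ^ 2 ^ 2"
    and \<alpha> \<beta> :: real
    and u1 :: "heis \<Rightarrow> heis \<Rightarrow> real"
    and Z :: "2 \<Rightarrow> heis \<Rightarrow> real"
  assumes "open \<Omega>" and "connected \<Omega>" and "\<Omega> \<noteq> {}" and "bounded \<Omega>"
    and "f \<in> L2 \<Omega>"
    and "\<And>i j. bounded (range (\<lambda>x. A x $ i $ j))"
    and "\<And>i j. (\<lambda>x. A x $ i $ j) \<in> borel_measurable lebesgue"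
    and "\<And>i j. Yperiodic (\<lambda>x. A x $ i $ j)"
    and "\<alpha> > 0" and "\<beta> > 0"
    and "\<And>x v. norm (A x *v v) \<le> \<beta> * norm v"
    and "\<And>x v. (A x *v v) \<bullet> v \<ge> \<alpha> * (norm v)\<^sup>2"
    and "two_scale_solution \<Omega> A f u u1"
    and "\<And>i. cell_solution A i (Z i)"
  shows "(AE x in lebesgue_on \<Omega>. quot_eq (u1 x) (\<lambda>y. \<Sum>i\<in>UNIV. Z i y * wX i \<Omega> u x)) \<and>
    (\<forall>\<phi>\<in>H1 \<Omega>.
       (LINT x|lebesgue_on \<Omega>. (effective_matrix A Z *v hgrad \<Omega> u x) \<bullet> hgrad \<Omega> \<phi> x)
       + measure lebesgue Ycell * (LINT x|lebesgue_on \<Omega>. u x * \<phi> x)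
       = measure lebesgue Ycell * (LINT x|lebesgue_on \<Omega>. f x * \<phi> x)) \<and>
    weak_neumann_solution \<Omega> (effective_matrix A Z) (measure lebesgue Ycell)
      (\<lambda>x. measure lebesgue Ycell * f x) u"
proof -
  interpret elliptic_matrix A \<alpha> \<beta> by unfold_locales (rule assms)+
  note Om = \<open>open \<Omega>\<close>
  have Oml: "\<Omega> \<in> sets lebesgue" using Om by simp
  let ?M = "lebesgue_on Ycell"
  have u: "u \<in> H1 \<Omega>" and u1: "u1 \<in> L2_H1per_quot \<Omega>"
    and eqn: "\<And>\<phi> \<phi>1. \<phi> \<in> H1 \<Omega> \<Longrightarrow> \<phi>1 \<in> L2_H1per_quot \<Omega> \<Longrightarrow>
        (LINT x|lebesgue_on \<Omega>. LINT y|?M.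
           (A y *v (hgrad \<Omega> u x + hgrad UNIV (u1 x) y)) \<bullet> (hgrad \<Omega> \<phi> x + hgrad UNIV (\<phi>1 x) y))
        + (LINT x|lebesgue_on \<Omega>. LINT y|?M. u x * \<phi> x)
        = (LINT x|lebesgue_on \<Omega>. LINT y|?M. f x * \<phi> x)"
    using assms(13) unfolding two_scale_solution_def by blast+
  have Z: "Z i \<in> H1per" for i using assms(14)[of i] by (simp add: cell_solution_def)
  define g where "g i = wX i \<Omega> u" for i
  have hg: "hgrad \<Omega> u x $ i = g i x" for i x by (simp add: g_def hgrad_def)
  \<comment> \<open>The two terms are subtracted one after the other, matching two applications of
    \<open>L2_H1per_quot_diff_scale\<close>.\<close>
  define w where "w x y = (u1 x y - g 1 x * Z 1 y) - g 2 x * Z 2 y" for x y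
  have w: "w \<in> L2_H1per_quot \<Omega>"
    unfolding w_def[abs_def] g_def by (intro L2_H1per_quot_diff_scale Oml u1 Z wX_in_L2 Om u)
  then have wH: "w x \<in> H1per" if "x \<in> \<Omega>" for x using that by (simp add: L2_H1per_quot_iff)
  have grad_u1: "AE y in ?M. hgrad UNIV (u1 x) y
      = hgrad UNIV (w x) y + g 1 x *\<^sub>R hgrad UNIV (Z 1) y + g 2 x *\<^sub>R hgrad UNIV (Z 2) y" if x: "x \<in> \<Omega>" for x
  proof -
    have "u1 x = (\<lambda>y. 1 * (1 * w x y + g 1 x * Z 1 y) + g 2 x * Z 2 y)" by (simp add: w_def)
    moreover have "AE y in ?M. hgrad UNIV (\<lambda>y. 1 * (1 * w x y + g 1 x * Z 1 y) + g 2 x * Z 2 y) y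
        = 1 *\<^sub>R hgrad UNIV (\<lambda>y. 1 * w x y + g 1 x * Z 1 y) y + g 2 x *\<^sub>R hgrad UNIV (Z 2) y"
      by (intro hgrad_linear_AE H1per_linear wH Z x)
    moreover have "AE y in ?M. hgrad UNIV (\<lambda>y. 1 * w x y + g 1 x * Z 1 y) y
        = 1 *\<^sub>R hgrad UNIV (w x) y + g 1 x *\<^sub>R hgrad UNIV (Z 1) y"
      by (intro hgrad_linear_AE wH Z x)
    ultimately show ?thesis by (auto elim!: eventually_elim2)
  qed
  have in_Om: "AE x in lebesgue_on \<Omega>. x \<in> \<Omega>" by (rule AE_I2) simp

  \<comment> \<open>The zero function is an admissible \<open>\<phi>\<close>, but its gradient too
    is a chosen representative and vanishes only almost everywhere.\<close>
  have "(LINT x|lebesgue_on \<Omega>. LINT y|?M.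
           (A y *v (hgrad \<Omega> u x + hgrad UNIV (u1 x) y)) \<bullet> (hgrad \<Omega> (\<lambda>x. 0) x + hgrad UNIV (w x) y)) = 0"
    using eqn[OF zero_in_H1 w] by simp
  moreover have "AE x in lebesgue_on \<Omega>. (LINT y|?M.
           (A y *v (hgrad \<Omega> u x + hgrad UNIV (u1 x) y)) \<bullet> (hgrad \<Omega> (\<lambda>x. 0) x + hgrad UNIV (w x) y)) = energy (w x)"
    using hgrad_zero_AE[OF Om] in_Om
  proof eventually_elim
    case (elim x)
    have "(LINT y|?M. (A y *v (hgrad \<Omega> u x + hgrad UNIV (u1 x) y)) \<bullet> (hgrad \<Omega> (\<lambda>x. 0) x + hgrad UNIV (w x) y))
      = (LINT y|?M. (A y *v (hgrad \<Omega> u x + (hgrad UNIV (w x) y + hgrad \<Omega> u x $ 1 *\<^sub>R hgrad UNIV (Z 1) y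
          + hgrad \<Omega> u x $ 2 *\<^sub>R hgrad UNIV (Z 2) y))) \<bullet> hgrad UNIV (w x) y)"
    proof (rule integral_lebesgue_on_cong_AE[OF Ycell_lebesgue])
      show "AE y in ?M. (A y *v (hgrad \<Omega> u x + hgrad UNIV (u1 x) y)) \<bullet> (hgrad \<Omega> (\<lambda>x. 0) x + hgrad UNIV (w x) y)
        = (A y *v (hgrad \<Omega> u x + (hgrad UNIV (w x) y + hgrad \<Omega> u x $ 1 *\<^sub>R hgrad UNIV (Z 1) y
          + hgrad \<Omega> u x $ 2 *\<^sub>R hgrad UNIV (Z 2) y))) \<bullet> hgrad UNIV (w x) y"
        using grad_u1[OF elim(2)] by eventually_elim (simp add: elim(1) hg)
    qed
    also have "\<dots> = energy (w x)" by (rule corrector_defect_form[OF assms(14) wH[OF elim(2)]])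
    finally show ?case .
  qed
  ultimately have energy0: "(LINT x|lebesgue_on \<Omega>. energy (w x)) = 0"
    using integral_lebesgue_on_cong_AE[OF Oml] by simp
  \<comment> \<open>The square root, unlike the energy itself, is globally Lipschitz in the quotient
    norm; squaring afterwards preserves measurability.\<close>
  have "(\<lambda>x. sqrt (energy (w x))) \<in> borel_measurable (lebesgue_on \<Omega>)"
    using w by (intro strongly_measurable_functional[OF Oml wH _ sqrt_energy_abs_diff]) (auto simp: L2_H1per_quot_iff)
  then have "(\<lambda>x. (sqrt (energy (w x)))\<^sup>2) \<in> borel_measurable (lebesgue_on \<Omega>)" by simp
  then have meas: "(\<lambda>x. energy (w x)) \<in> borel_measurable (lebesgue_on \<Omega>)" by (simp add: energy_nonneg)
  have "integrable (lebesgue_on \<Omega>) (\<lambda>x. energy (w x))"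
  proof (rule Bochner_Integration.integrable_bound[OF _ meas])
    \<comment> \<open>The majorant is the square of the bound in \<open>sqrt_energy_le\<close>; its
      integrability is part of membership in the Bochner space.\<close>
    show "integrable (lebesgue_on \<Omega>) (\<lambda>x. \<beta> * (quot_norm (w x))\<^sup>2)" using w by (simp add: L2_H1per_quot_iff)
    show "AE x in lebesgue_on \<Omega>. norm (energy (w x)) \<le> norm (\<beta> * (quot_norm (w x))\<^sup>2)"
      using in_Om
    proof eventually_elim
      case (elim x)
      have "(sqrt (energy (w x)))\<^sup>2 \<le> (sqrt \<beta> * quot_norm (w x))\<^sup>2"
        by (intro power_mono sqrt_energy_le wH elim) (simp add: energy_nonneg)
      then show ?case using pos by (simp add: energy_nonneg power_mult_distrib)
    qed
  qed
  from integral_nonneg_eq_0_iff_AE[OF this] energy0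
  have "AE x in lebesgue_on \<Omega>. energy (w x) = 0" by (simp add: energy_nonneg)
  \<comment> \<open>Membership in \<open>\<Omega>\<close> is recorded alongside, since
    \<open>wH\<close> and \<open>grad_u1\<close> are available only there.\<close>
  with in_Om have grad_w: "AE x in lebesgue_on \<Omega>. x \<in> \<Omega> \<and> (AE y in ?M. hgrad UNIV (w x) y = 0)"
    by eventually_elim (simp add: hgrad_eq_0_of_energy_eq_0 wH)

  have corrector: "AE x in lebesgue_on \<Omega>. quot_eq (u1 x) (\<lambda>y. \<Sum>i\<in>UNIV. Z i y * wX i \<Omega> u x)"
    using grad_w
  proof eventually_elim
    case (elim x)
    then obtain c where "AE y in lebesgue. w x y = c"
      using AE_const_of_hgrad_eq_0[OF wH] by blast
    then have "AE y in lebesgue. u1 x y = (\<Sum>i\<in>UNIV. Z i y * wX i \<Omega> u x) + c"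
      by eventually_elim (simp add: w_def g_def sum_2 algebra_simps)
    then show ?case by (auto simp: quot_eq_def)
  qed

  have effective: "(LINT x|lebesgue_on \<Omega>. (effective_matrix A Z *v hgrad \<Omega> u x) \<bullet> hgrad \<Omega> \<phi> x)
       + measure lebesgue Ycell * (LINT x|lebesgue_on \<Omega>. u x * \<phi> x)
       = measure lebesgue Ycell * (LINT x|lebesgue_on \<Omega>. f x * \<phi> x)" if \<phi>: "\<phi> \<in> H1 \<Omega>" for \<phi>
  proof -
    have "AE x in lebesgue_on \<Omega>. (LINT y|?M.
           (A y *v (hgrad \<Omega> u x + hgrad UNIV (u1 x) y)) \<bullet> (hgrad \<Omega> \<phi> x + hgrad UNIV (\<lambda>y. 0) y))
        = (effective_matrix A Z *v hgrad \<Omega> u x) \<bullet> hgrad \<Omega> \<phi> x"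
      using grad_w
    proof eventually_elim
      case (elim x)
      then have x: "x \<in> \<Omega>" and gw: "AE y in ?M. hgrad UNIV (w x) y = 0" by auto
      \<comment> \<open>The right side becomes an integral over the cell as well, so the integrands
        can be compared almost everywhere; the gradients of \<open>w x\<close> and of the zero test
        function drop out.\<close>
      show ?case unfolding effective_matrix_form[OF Z]
      proof (rule integral_lebesgue_on_cong_AE[OF Ycell_lebesgue])
        show "AE y in ?M. (A y *v (hgrad \<Omega> u x + hgrad UNIV (u1 x) y)) \<bullet> (hgrad \<Omega> \<phi> x + hgrad UNIV (\<lambda>y. 0) y)
          = (A y *v (hgrad \<Omega> u x + (hgrad \<Omega> u x $ 1 *\<^sub>R hgrad UNIV (Z 1) y
            + hgrad \<Omega> u x $ 2 *\<^sub>R hgrad UNIV (Z 2) y))) \<bullet> hgrad \<Omega> \<phi> x"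
          using grad_u1[OF x] gw hgrad_const_AE[of 0] by eventually_elim (simp add: hg)
      qed
    qed
    \<comment> \<open>The inner integrals of \<open>u x * \<phi> x\<close> and
      \<open>f x * \<phi> x\<close> have integrands constant in \<open>y\<close>; they produce the
      factor |Y|.\<close>
    from integral_lebesgue_on_cong_AE[OF Oml this] eqn[OF \<phi> zero_in_L2_H1per_quot] show ?thesis
      by (simp add: measure_restrict_space Ycell_lebesgue mult.assoc)
  qed
  then have "weak_neumann_solution \<Omega> (effective_matrix A Z) (measure lebesgue Ycell)
      (\<lambda>x. measure lebesgue Ycell * f x) u"
    unfolding weak_neumann_solution_def using u by (simp add: mult.assoc)
  then show ?thesis using corrector effective by blast
qed

end
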